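(* Let $(M,\phi,\xi,\eta,g)$ be a $5$-dimensional nearly Sasakian non-Sasakian manifold, let $h$ be defined by $\nabla_X\xi=-\phi X+hX$, and let $\lambda\neq0$ be a real constant with $h^2=-\lambda^2(I-\eta\otimes\xi)$. Let $\bar\nabla$ be the canonical connection corresponding to $r=\frac12$, i.e. $\bar\nabla_XY=\nabla_XY+H(X,Y)$ with $$H(X,Y)=\tfrac12(\nabla_X\phi)\phi Y-\tfrac12\,\eta(X)\phi Y+\eta(Y)(\phi-h)X-\tfrac12 g((\phi-h)X,Y)\xi.$$ Then $\bar\nabla$ parallelizes the $SU(2)$-structure $\{(\phi_i,\xi,\eta,g)\}_{i\in\{1,2,3\}}$, $\phi_1=\frac1\lambda h$, $\phi_2=\frac1\lambda\phi h$, $\phi_3=\phi$, or equivalently $(\eta,\omega_1,\omega_2,\omega_3)$ with $\omega_i(X,Y)=g(\phi_iX,Y)$, associated to the nearly Sasakian structure. Furthermore, the torsion of $\bar\nabla$ is $$\bar T(X,Y)=\tfrac32\{\eta(Y)(\phi X-hX)-\eta(X)(\phi Y-hY)\}-2g(\phi X-hX,Y)\xi,$$ and it satisfies $\bar\nabla\bar T=0$. Moreover, the Sasaki-Einstein $SU(2)$-structure $$\tilde\eta=\sqrt{1+\lambda^2}\,\eta,\quad \tilde\omega_1=\sqrt{1+\lambda^2}\,(\omega_1+\lambda\omega_3),\quad\tilde\omega_2=(1+\lambda^2)\omega_2,\quad\tilde\omega_3=\sqrt{1+\lambda^2}\,(\omega_3-\lambda\omega_1)$$ is also parallel with respect to $\bar\nabla$,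 and $$H(X,Y)=\tilde g(X,\tilde\phi Y)\tilde\xi-\tfrac12\tilde\eta(X)\tilde\phi Y+\tilde\eta(Y)\tilde\phi X,$$ where $\tilde\phi=\frac{1}{\sqrt{1+\lambda^2}}(\phi-h)$, $\tilde\xi=\frac1{\sqrt{1+\lambda^2}}\xi$, $\tilde g=(1+\lambda^2)g$; therefore $\bar\nabla$ coincides with the Okumura connection associated to the Sasakian structure $(\tilde\phi,\tilde\xi,\tilde\eta,\tilde g)$ for $r=\frac12$.
   Context: All manifolds are smooth and connected; $\nabla$ is the Levi-Civita connection of $g$. An almost contact metric structure $(\phi,\xi,\eta,g)$ on $M^{2n+1}$ consists of a $(1,1)$-tensor field $\phi$, a vector field $\xi$, a $1$-form $\eta$ and a Riemannian metric $g$ with $\phi^2=-I+\eta\otimes\xi$, $\eta(\xi)=1$, $g(\phi X,\phi Y)=g(X,Y)-\eta(X)\eta(Y)$. It is Sasakian if $(\nabla_X\phi)Y=g(X,Y)\xi-\eta(Y)X$, and nearly Sasakian if $(\nabla_X\phi)Y+(\nabla_Y\phi)X=2g(X,Y)\xi-\eta(X)Y-\eta(Y)X$ for all vector fields $X,Y$. On a $5$-dimensional nearly Sasakian non-Sasakian manifold, with the $(1,1)$-tensor field $h$ defined by $\nabla_X\xi=-\phi X+hX$, a real constant $\lambda\neq0$ such that $h^2=-\lambda^2(I-\eta\otimes\xi)$ always exists. The Okumura connection with parameter $r$ of a Sasakian structure $(\phi,\xi,\eta,g)$ is $\nabla_XY+g(X,\phi Y)\xi-r\,\eta(X)\phi Y+\eta(Y)\phi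 X$, with $\nabla$ the Levi-Civita connection of its metric (note that $g$ and $\tilde g=(1+\lambda^2)g$ have the same Levi-Civita connection). An $SU(2)$-structure on a $5$-manifold consists of three almost contact metric structures $(\phi_i,\xi,\eta,g)$ with $\phi_i\phi_j=\phi_k=-\phi_j\phi_i$ for even permutations $(i,j,k)$ of $(1,2,3)$, equivalently of the forms $(\eta,\omega_1,\omega_2,\omega_3)$ with $\omega_i(X,Y)=g(\phi_iX,Y)$. It is Sasaki-Einstein if $d\eta=-2\omega_3$, $d\omega_1=3\eta\wedge\omega_2$, $d\omega_2=-3\eta\wedge\omega_1$; for the $SU(2)$-structure $(\eta,\omega_1,\omega_2,\omega_3)$ associated to a $5$-dimensional nearly Sasakian non-Sasakian manifold by $\phi_1=\frac1\lambda h$, $\phi_2=\frac1\lambda\phi h$, $\phi_3=\phi$, the structure $(\tilde\eta,\tilde\omega_1,\tilde\omega_2,\tilde\omega_3)$ given by $\tilde\eta=\sqrt{1+\lambda^2}\,\eta$, $\tilde\omega_1=\sqrt{1+\lambda^2}\,(\omega_1+\lambda\omega_3)$, $\tilde\omega_2=(1+\lambda^2)\omega_2$, $\tilde\omega_3=\sqrt{1+\lambda^2}\,(\omega_3-\lambda\omega_1)$ is a Sasaki-Einstein $SU(2)$-structure with Sasakian structure $(\tilde\phi_3,\tilde\xi,\tilde\eta,\tilde g)=(\tilde\phi,\tilde\xi,\tilde\eta,\tilde g)$, where $\tilde\phi=\frac{1}{\sqrt{1+\lambda^2}}(\phi-h)$, $\tilde\xi=\frac1{\sqrt{1+\lambda^2}}\xi$,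 $\tilde g=(1+\lambda^2)g$. *)

theory Defs
  imports "HOL-Analysis.Analysis" "HOL-Library.Function_Algebras"
begin

text \<open>Smooth manifolds are given by a smooth atlas on a Hausdorff, second countable type. Sums,
  products and numerals of functions, vector fields and tensors are pointwise, via
  \<^theory>\<open>HOL-Library.Function_Algebras\<close>.\<close>

section \<open>Smooth manifolds\<close>

text \<open>For open \<open>S\<close>: \<open>f\<close> is of class \<open>C\<^sup>k\<close> on \<open>S\<close>.\<close>

primrec Ck_on :: "nat \<Rightarrow> 'a::euclidean_space set \<Rightarrow> ('a \<Rightarrow> 'b::real_normed_vector) \<Rightarrow> bool" where
  "Ck_on 0 S f \<longleftrightarrow> continuous_on S f"
| "Ck_on (Suc k) S f \<longleftrightarrow>
     f differentiable_on S \<and> (\<forall>v. Ck_on k S (\<lambda>x. frechet_derivative f (at x) v))"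

definition smooth_on :: "'a::euclidean_space set \<Rightarrow> ('a \<Rightarrow> 'b::real_normed_vector) \<Rightarrow> bool" where
  "smooth_on S f \<longleftrightarrow> (\<forall>k. Ck_on k S f)"

type_synonym ('m, 'e) atlas = "('m set \<times> ('m \<Rightarrow> 'e)) set"

definition chart :: "'m::topological_space set \<Rightarrow> ('m \<Rightarrow> 'e::euclidean_space) \<Rightarrow> bool" where
  "chart U c \<longleftrightarrow> open U \<and> open (c ` U) \<and> homeomorphism U (c ` U) c (inv_into U c)"

definition smooth_atlas ::
    "('m::{t2_space,second_countable_topology}, 'e::euclidean_space) atlas \<Rightarrow> bool" where
  "smooth_atlas A \<longleftrightarrow>
     (\<forall>(U, c) \<in> A. chart U c) \<and>
     (\<Union>(U, c) \<in> A. U) = UNIV \<and>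
     (\<forall>(U, c) \<in> A. \<forall>(V, d) \<in> A. smooth_on (c ` (U \<inter> V)) (d \<circ> inv_into U c))"

definition smooth_functions ::
    "('m::topological_space, 'e::euclidean_space) atlas \<Rightarrow> ('m \<Rightarrow> real) set" where
  "smooth_functions A = {f. \<forall>(U, c) \<in> A. smooth_on (c ` U) (f \<circ> inv_into U c)}"

text \<open>Tangent vectors at \<open>p\<close> are the derivations at \<open>p\<close> of the algebra of smooth functions. They are
  represented by functionals on all functions; the value \<open>0\<close> on non-smooth functions makes the
  representation unique.\<close>

type_synonym 'm tvector = "('m \<Rightarrow> real) \<Rightarrow> real"
type_synonym 'm vfield = "'m \<Rightarrow> 'm tvector"

definition tangent_space ::
    "('m::topological_space, 'e::euclidean_space) atlas \<Rightarrow> 'm \<Rightarrow> 'm tvector set" where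
  "tangent_space A p = {v.
     (\<forall>f. f \<notin> smooth_functions A \<longrightarrow> v f = 0) \<and>
     (\<forall>f \<in> smooth_functions A. \<forall>a. v (\<lambda>x. a * f x) = a * v f) \<and>
     (\<forall>f \<in> smooth_functions A. \<forall>k \<in> smooth_functions A.
        v (f + k) = v f + v k \<and> v (f * k) = f p * v k + k p * v f)}"

definition vector_fields ::
    "('m::topological_space, 'e::euclidean_space) atlas \<Rightarrow> 'm vfield set" where
  "vector_fields A = {X. (\<forall>p. X p \<in> tangent_space A p) \<and>
     (\<forall>f \<in> smooth_functions A. (\<lambda>p. X p f) \<in> smooth_functions A)}"

definition fscale :: "('m \<Rightarrow> real) \<Rightarrow> 'm vfield \<Rightarrow> 'm vfield"  (infixr "\<odot>" 75) where
  "f \<odot> X = (\<lambda>p k. f p * X p k)"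

abbreviation rscale :: "real \<Rightarrow> 'm vfield \<Rightarrow> 'm vfield"  (infixr "\<odot>\<^sub>R" 75) where
  "a \<odot>\<^sub>R X \<equiv> (\<lambda>_. a) \<odot> X"

definition vapply :: "'m vfield \<Rightarrow> ('m \<Rightarrow> real) \<Rightarrow> ('m \<Rightarrow> real)"  (infixr "\<bullet>\<^sub>v" 75) where
  "X \<bullet>\<^sub>v f = (\<lambda>p. X p f)"

definition lie_bracket :: "'m vfield \<Rightarrow> 'm vfield \<Rightarrow> 'm vfield" where
  "lie_bracket X Y = (\<lambda>p f. X p (Y \<bullet>\<^sub>v f) - Y p (X \<bullet>\<^sub>v f))"


section \<open>Tensor fields\<close>

text \<open>Tensor fields are maps on vector fields that are multilinear over the smooth functions. Only
  their values on \<^const>\<open>vector_fields\<close> are relevant.\<close>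

type_synonym 'm form1 = "'m vfield \<Rightarrow> 'm \<Rightarrow> real"
type_synonym 'm form2 = "'m vfield \<Rightarrow> 'm vfield \<Rightarrow> 'm \<Rightarrow> real"
type_synonym 'm endo = "'m vfield \<Rightarrow> 'm vfield"
type_synonym 'm vform2 = "'m vfield \<Rightarrow> 'm vfield \<Rightarrow> 'm vfield"

definition one_form ::
    "('m::topological_space, 'e::euclidean_space) atlas \<Rightarrow> 'm form1 \<Rightarrow> bool" where
  "one_form A \<alpha> \<longleftrightarrow>
     (\<forall>X \<in> vector_fields A. \<alpha> X \<in> smooth_functions A) \<and>
     (\<forall>X \<in> vector_fields A. \<forall>Y \<in> vector_fields A. \<alpha> (X + Y) = \<alpha> X + \<alpha> Y) \<and>
     (\<forall>f \<in> smooth_functions A. \<forall>X \<in> vector_fields A. \<alpha> (f \<odot> X) = f * \<alpha> X)"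

definition endo_field ::
    "('m::topological_space, 'e::euclidean_space) atlas \<Rightarrow> 'm endo \<Rightarrow> bool" where
  "endo_field A \<phi> \<longleftrightarrow>
     (\<forall>X \<in> vector_fields A. \<phi> X \<in> vector_fields A) \<and>
     (\<forall>X \<in> vector_fields A. \<forall>Y \<in> vector_fields A. \<phi> (X + Y) = \<phi> X + \<phi> Y) \<and>
     (\<forall>f \<in> smooth_functions A. \<forall>X \<in> vector_fields A. \<phi> (f \<odot> X) = f \<odot> \<phi> X)"

definition riemannian_metric ::
    "('m::topological_space, 'e::euclidean_space) atlas \<Rightarrow> 'm form2 \<Rightarrow> bool" where
  "riemannian_metric A g \<longleftrightarrow>
     (\<forall>X \<in> vector_fields A. one_form A (g X)) \<and>
     (\<forall>X \<in> vector_fields A. \<forall>Y \<in> vector_fields A. g X Y = g Y X) \<and>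
     (\<forall>X \<in> vector_fields A. \<forall>p. X p \<noteq> 0 \<longrightarrow> g X X p > 0)"

text \<open>The exterior derivative and the exterior product are normalised without the factors
  \<open>1/2\<close> and \<open>1/3\<close>; with this convention a Sasakian structure satisfies
  \<open>d\<eta>(X,Y) = -2 g(\<phi>X,Y)\<close>.\<close>

definition ext_deriv1 :: "'m form1 \<Rightarrow> 'm form2" where
  "ext_deriv1 \<alpha> X Y = X \<bullet>\<^sub>v \<alpha> Y - Y \<bullet>\<^sub>v \<alpha> X - \<alpha> (lie_bracket X Y)"

definition ext_deriv2 :: "'m form2 \<Rightarrow> 'm vfield \<Rightarrow> 'm vfield \<Rightarrow> 'm vfield \<Rightarrow> 'm \<Rightarrow> real" where
  "ext_deriv2 \<omega> X Y Z =
     X \<bullet>\<^sub>v \<omega> Y Z + Y \<bullet>\<^sub>v \<omega> Z X + Z \<bullet>\<^sub>v \<omega> X Y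
     - \<omega> (lie_bracket X Y) Z - \<omega> (lie_bracket Y Z) X - \<omega> (lie_bracket Z X) Y"

definition wedge12 :: "'m form1 \<Rightarrow> 'm form2 \<Rightarrow> 'm vfield \<Rightarrow> 'm vfield \<Rightarrow> 'm vfield \<Rightarrow> 'm \<Rightarrow> real" where
  "wedge12 \<alpha> \<omega> X Y Z = \<alpha> X * \<omega> Y Z + \<alpha> Y * \<omega> Z X + \<alpha> Z * \<omega> X Y"


section \<open>Affine connections\<close>

type_synonym 'm connection = "'m vfield \<Rightarrow> 'm vfield \<Rightarrow> 'm vfield"

definition affine_connection ::
    "('m::topological_space, 'e::euclidean_space) atlas \<Rightarrow> 'm connection \<Rightarrow> bool" where
  "affine_connection A D \<longleftrightarrow>
     (\<forall>X \<in> vector_fields A. \<forall>Y \<in> vector_fields A. D X Y \<in> vector_fields A) \<and>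
     (\<forall>X \<in> vector_fields A. \<forall>Y \<in> vector_fields A. \<forall>Z \<in> vector_fields A.
        D (X + Y) Z = D X Z + D Y Z \<and> D X (Y + Z) = D X Y + D X Z) \<and>
     (\<forall>f \<in> smooth_functions A. \<forall>X \<in> vector_fields A. \<forall>Y \<in> vector_fields A.
        D (f \<odot> X) Y = f \<odot> D X Y \<and> D X (f \<odot> Y) = (X \<bullet>\<^sub>v f) \<odot> Y + f \<odot> D X Y)"

definition torsion :: "'m connection \<Rightarrow> 'm vform2" where
  "torsion D X Y = D X Y - D Y X - lie_bracket X Y"

definition cov_form1 :: "'m connection \<Rightarrow> 'm vfield \<Rightarrow> 'm form1 \<Rightarrow> 'm form1" where
  "cov_form1 D X \<alpha> Y = X \<bullet>\<^sub>v \<alpha> Y - \<alpha> (D X Y)"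

definition cov_form2 :: "'m connection \<Rightarrow> 'm vfield \<Rightarrow> 'm form2 \<Rightarrow> 'm form2" where
  "cov_form2 D X \<omega> Y Z = X \<bullet>\<^sub>v \<omega> Y Z - \<omega> (D X Y) Z - \<omega> Y (D X Z)"

definition cov_endo :: "'m connection \<Rightarrow> 'm vfield \<Rightarrow> 'm endo \<Rightarrow> 'm endo" where
  "cov_endo D X \<phi> Y = D X (\<phi> Y) - \<phi> (D X Y)"

definition cov_vform2 :: "'m connection \<Rightarrow> 'm vfield \<Rightarrow> 'm vform2 \<Rightarrow> 'm vform2" where
  "cov_vform2 D X T Y Z = D X (T Y Z) - T (D X Y) Z - T Y (D X Z)"

definition parallel_vfield ::
    "('m::topological_space, 'e::euclidean_space) atlas \<Rightarrow> 'm connection \<Rightarrow> 'm vfield \<Rightarrow> bool" where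
  "parallel_vfield A D \<xi> \<longleftrightarrow> (\<forall>X \<in> vector_fields A. D X \<xi> = 0)"

definition parallel_form1 ::
    "('m::topological_space, 'e::euclidean_space) atlas \<Rightarrow> 'm connection \<Rightarrow> 'm form1 \<Rightarrow> bool" where
  "parallel_form1 A D \<alpha> \<longleftrightarrow> (\<forall>X \<in> vector_fields A. \<forall>Y \<in> vector_fields A. cov_form1 D X \<alpha> Y = 0)"

definition parallel_form2 ::
    "('m::topological_space, 'e::euclidean_space) atlas \<Rightarrow> 'm connection \<Rightarrow> 'm form2 \<Rightarrow> bool" where
  "parallel_form2 A D \<omega> \<longleftrightarrow>
     (\<forall>X \<in> vector_fields A. \<forall>Y \<in> vector_fields A. \<forall>Z \<in> vector_fields A. cov_form2 D X \<omega> Y Z = 0)"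

definition parallel_endo ::
    "('m::topological_space, 'e::euclidean_space) atlas \<Rightarrow> 'm connection \<Rightarrow> 'm endo \<Rightarrow> bool" where
  "parallel_endo A D \<phi> \<longleftrightarrow> (\<forall>X \<in> vector_fields A. \<forall>Y \<in> vector_fields A. cov_endo D X \<phi> Y = 0)"

definition parallel_vform2 ::
    "('m::topological_space, 'e::euclidean_space) atlas \<Rightarrow> 'm connection \<Rightarrow> 'm vform2 \<Rightarrow> bool" where
  "parallel_vform2 A D T \<longleftrightarrow>
     (\<forall>X \<in> vector_fields A. \<forall>Y \<in> vector_fields A. \<forall>Z \<in> vector_fields A. cov_vform2 D X T Y Z = 0)"

text \<open>This determines \<open>D\<close> uniquely on vector fields.\<close>

definition levi_civita ::
    "('m::topological_space, 'e::euclidean_space) atlas \<Rightarrow> 'm form2 \<Rightarrow> 'm connection \<Rightarrow> bool" where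
  "levi_civita A g D \<longleftrightarrow> riemannian_metric A g \<and> affine_connection A D \<and>
     (\<forall>X \<in> vector_fields A. \<forall>Y \<in> vector_fields A. torsion D X Y = 0) \<and>
     parallel_form2 A D g"


section \<open>Almost contact metric structures\<close>

definition almost_contact_metric ::
    "('m::topological_space, 'e::euclidean_space) atlas \<Rightarrow>
     'm endo \<Rightarrow> 'm vfield \<Rightarrow> 'm form1 \<Rightarrow> 'm form2 \<Rightarrow> bool" where
  "almost_contact_metric A \<phi> \<xi> \<eta> g \<longleftrightarrow>
     endo_field A \<phi> \<and> \<xi> \<in> vector_fields A \<and> one_form A \<eta> \<and> riemannian_metric A g \<and>
     (\<forall>X \<in> vector_fields A. \<phi> (\<phi> X) = - X + \<eta> X \<odot> \<xi>) \<and>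
     \<eta> \<xi> = 1 \<and>
     (\<forall>X \<in> vector_fields A. \<forall>Y \<in> vector_fields A. g (\<phi> X) (\<phi> Y) = g X Y - \<eta> X * \<eta> Y)"

text \<open>In the next two definitions \<open>D\<close> is the Levi-Civita connection of \<open>g\<close>.\<close>

definition sasakian ::
    "('m::topological_space, 'e::euclidean_space) atlas \<Rightarrow> 'm connection \<Rightarrow>
     'm endo \<Rightarrow> 'm vfield \<Rightarrow> 'm form1 \<Rightarrow> 'm form2 \<Rightarrow> bool" where
  "sasakian A D \<phi> \<xi> \<eta> g \<longleftrightarrow>
     almost_contact_metric A \<phi> \<xi> \<eta> g \<and> levi_civita A g D \<and>
     (\<forall>X \<in> vector_fields A. \<forall>Y \<in> vector_fields A.
        cov_endo D X \<phi> Y = g X Y \<odot> \<xi> - \<eta> Y \<odot> X)"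

definition nearly_sasakian ::
    "('m::topological_space, 'e::euclidean_space) atlas \<Rightarrow> 'm connection \<Rightarrow>
     'm endo \<Rightarrow> 'm vfield \<Rightarrow> 'm form1 \<Rightarrow> 'm form2 \<Rightarrow> bool" where
  "nearly_sasakian A D \<phi> \<xi> \<eta> g \<longleftrightarrow>
     almost_contact_metric A \<phi> \<xi> \<eta> g \<and> levi_civita A g D \<and>
     (\<forall>X \<in> vector_fields A. \<forall>Y \<in> vector_fields A.
        cov_endo D X \<phi> Y + cov_endo D Y \<phi> X = (2 * g X Y) \<odot> \<xi> - \<eta> X \<odot> Y - \<eta> Y \<odot> X)"

definition okumura ::
    "'m connection \<Rightarrow> 'm endo \<Rightarrow> 'm vfield \<Rightarrow> 'm form1 \<Rightarrow> 'm form2 \<Rightarrow> real \<Rightarrow> 'm connection" where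
  "okumura D \<phi> \<xi> \<eta> g r X Y =
     D X Y + g X (\<phi> Y) \<odot> \<xi> - r \<odot>\<^sub>R (\<eta> X \<odot> \<phi> Y) + \<eta> Y \<odot> \<phi> X"


section \<open>SU(2)-structures in dimension five\<close>

definition fundamental_form :: "'m form2 \<Rightarrow> 'm endo \<Rightarrow> 'm form2" where
  "fundamental_form g \<phi> X Y = g (\<phi> X) Y"

definition su2_structure ::
    "('m::topological_space, real^5) atlas \<Rightarrow>
     'm endo \<Rightarrow> 'm endo \<Rightarrow> 'm endo \<Rightarrow> 'm vfield \<Rightarrow> 'm form1 \<Rightarrow> 'm form2 \<Rightarrow> bool" where
  "su2_structure A \<phi>1 \<phi>2 \<phi>3 \<xi> \<eta> g \<longleftrightarrow>
     almost_contact_metric A \<phi>1 \<xi> \<eta> g \<and>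
     almost_contact_metric A \<phi>2 \<xi> \<eta> g \<and>
     almost_contact_metric A \<phi>3 \<xi> \<eta> g \<and>
     (\<forall>X \<in> vector_fields A.
        \<phi>1 (\<phi>2 X) = \<phi>3 X \<and> \<phi>2 (\<phi>1 X) = - \<phi>3 X \<and>
        \<phi>2 (\<phi>3 X) = \<phi>1 X \<and> \<phi>3 (\<phi>2 X) = - \<phi>1 X \<and>
        \<phi>3 (\<phi>1 X) = \<phi>2 X \<and> \<phi>1 (\<phi>3 X) = - \<phi>2 X)"

definition parallel_su2 ::
    "('m::topological_space, real^5) atlas \<Rightarrow> 'm connection \<Rightarrow>
     'm endo \<Rightarrow> 'm endo \<Rightarrow> 'm endo \<Rightarrow> 'm vfield \<Rightarrow> 'm form1 \<Rightarrow> 'm form2 \<Rightarrow> bool" where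
  "parallel_su2 A D \<phi>1 \<phi>2 \<phi>3 \<xi> \<eta> g \<longleftrightarrow>
     parallel_endo A D \<phi>1 \<and> parallel_endo A D \<phi>2 \<and> parallel_endo A D \<phi>3 \<and>
     parallel_vfield A D \<xi> \<and> parallel_form1 A D \<eta> \<and> parallel_form2 A D g"

definition su2_forms ::
    "('m::topological_space, real^5) atlas \<Rightarrow>
     'm endo \<Rightarrow> 'm endo \<Rightarrow> 'm endo \<Rightarrow> 'm form2 \<Rightarrow> 'm form2 \<Rightarrow> 'm form2 \<Rightarrow> 'm form2 \<Rightarrow> bool" where
  "su2_forms A \<phi>1 \<phi>2 \<phi>3 g \<omega>1 \<omega>2 \<omega>3 \<longleftrightarrow>
     (\<forall>X \<in> vector_fields A. \<forall>Y \<in> vector_fields A.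
        \<omega>1 X Y = fundamental_form g \<phi>1 X Y \<and>
        \<omega>2 X Y = fundamental_form g \<phi>2 X Y \<and>
        \<omega>3 X Y = fundamental_form g \<phi>3 X Y)"

definition parallel_su2_forms ::
    "('m::topological_space, real^5) atlas \<Rightarrow> 'm connection \<Rightarrow>
     'm form1 \<Rightarrow> 'm form2 \<Rightarrow> 'm form2 \<Rightarrow> 'm form2 \<Rightarrow> bool" where
  "parallel_su2_forms A D \<eta> \<omega>1 \<omega>2 \<omega>3 \<longleftrightarrow>
     parallel_form1 A D \<eta> \<and>
     parallel_form2 A D \<omega>1 \<and> parallel_form2 A D \<omega>2 \<and> parallel_form2 A D \<omega>3"

definition sasaki_einstein_equations ::
    "('m::topological_space, real^5) atlas \<Rightarrow>
     'm form1 \<Rightarrow> 'm form2 \<Rightarrow> 'm form2 \<Rightarrow> 'm form2 \<Rightarrow> bool" where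
  "sasaki_einstein_equations A \<eta> \<omega>1 \<omega>2 \<omega>3 \<longleftrightarrow>
     (\<forall>X \<in> vector_fields A. \<forall>Y \<in> vector_fields A.
        ext_deriv1 \<eta> X Y = - 2 * \<omega>3 X Y) \<and>
     (\<forall>X \<in> vector_fields A. \<forall>Y \<in> vector_fields A. \<forall>Z \<in> vector_fields A.
        ext_deriv2 \<omega>1 X Y Z = 3 * wedge12 \<eta> \<omega>2 X Y Z \<and>
        ext_deriv2 \<omega>2 X Y Z = - 3 * wedge12 \<eta> \<omega>1 X Y Z)"

end

theory Submission
  imports Defs
begin

text \<open>Write \<open>\<nabla>\<phi>\<close> as \<open>g(X,Y)\<xi> - \<eta>(Y)X\<close> plus a remainder. The nearly Sasakian condition and the skewness of
  \<open>\<phi>\<close> make the remainder a 3-form, and its \<open>\<xi>\<close>-components are expressed by \<open>h\<close>. Its horizontal part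
  anticommutes with \<open>\<phi>\<close>, so it is the real part of a \<open>(3,0)\<close>-form in complex dimension two and
  vanishes. Likewise \<open>h\<^sup>2 = -\<lambda>\<^sup>2(I - \<eta> \<otimes> \<xi>)\<close> and \<open>\<phi>h + h\<phi> = 0\<close> determine \<open>\<nabla>h\<close> up to a term
  \<open>\<beta> \<otimes> \<phi>h\<close>, which \<open>d(d\<eta>) = 0\<close> excludes. With both derivatives explicit, \<open>H\<close> reduces to
  \<open>-(1/2) \<eta>(X)(\<phi>-h)Y + \<eta>(Y)(\<phi>-h)X - g((\<phi>-h)X,Y)\<xi>\<close>, and every assertion becomes an algebraic identity.
  The dimension enters pointwise: in a chart, a derivation is determined by its five coordinates.\<close>

section \<open>Functions of class \<open>C\<^sup>k\<close> on Euclidean space\<close>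

text \<open>Tangent vectors are derivations of the globally defined smooth functions, and a tensor
  field is a function-linear map on global vector fields. Hadamard's lemma then turns a derivation
  into a combination of partial derivatives, which yields the upper bound on the dimension that both
  vanishing arguments rest on. The basis at a point is built from one global horizontal field Z that
  is nonzero there, moved around by \<phi> and h; since \<open>lam\<close> is nonzero this spans,
  and no orthonormal frame has to be constructed or extended. The two remainders differ in kind.
  That of \<nabla>\<phi> is skew in all slots by the nearly Sasakian condition. That of \<nabla>h is
  skew in its last two slots only, and the cyclic identity coming from d(d\<eta>) = 0 has to replace
  the missing symmetry.\<close>

lemma Ck_on_has_derivative:
  assumes "open S" "Ck_on (Suc k) S f" "x \<in> S"
  shows "(f has_derivative frechet_derivative f (at x)) (at x)"
proof -
  have "f differentiable (at x within S)"
    using assms(2,3) by (simp add: differentiable_on_def)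
  then show ?thesis
    using assms(1,3) frechet_derivative_works at_within_open by metis
qed

lemma Ck_on_SucD: "Ck_on (Suc k) S f \<Longrightarrow> Ck_on k S (\<lambda>x. frechet_derivative f (at x) v)"
  by simp

lemma Ck_on_cong:
  assumes "open S" "\<And>x. x \<in> S \<Longrightarrow> f x = g x" "Ck_on k S f"
  shows "Ck_on k S g"
  using assms(2,3)
proof (induction k arbitrary: f g)
  case 0
  then show ?case using continuous_on_cong[of S S f g] by simp
next
  case (Suc k)
  have d: "(g has_derivative frechet_derivative f (at x)) (at x)" if "x \<in> S" for x
  proof (rule has_derivative_transform_within_open[OF _ \<open>open S\<close> that])
    show "(f has_derivative frechet_derivative f (at x)) (at x)"
      by (rule Ck_on_has_derivative[OF \<open>open S\<close> Suc.prems(2) that])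
  qed (use Suc.prems in auto)
  have "frechet_derivative f (at x) = frechet_derivative g (at x)" if "x \<in> S" for x
    using frechet_derivative_at[OF d[OF that]] .
  then have "Ck_on k S (\<lambda>x. frechet_derivative g (at x) v)" for v
    by (intro Suc.IH[OF _ Ck_on_SucD[OF Suc.prems(2), of v]]) simp
  moreover have "g differentiable_on S"
    unfolding differentiable_on_def differentiable_def
    using has_derivative_at_withinI[OF d] by blast
  ultimately show ?case by simp
qed

text \<open>Derivatives at points of an open set are unique, so any explicit formula may stand for
  \<open>frechet_derivative\<close>. This keeps the chosen derivative out of the inductions that
  follow.\<close>

lemma Ck_on_Suc_intro:
  assumes "open S" "\<And>x. x \<in> S \<Longrightarrow> (f has_derivative f' x) (at x)"
    and "\<And>v. Ck_on k S (\<lambda>x. f' x v)"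
  shows "Ck_on (Suc k) S f"
proof -
  have "frechet_derivative f (at x) = f' x" if "x \<in> S" for x
    using frechet_derivative_at[OF assms(2)[OF that]] by simp
  then have "Ck_on k S (\<lambda>x. frechet_derivative f (at x) v)" for v
    by (intro Ck_on_cong[OF assms(1) _ assms(3)[of v]]) simp
  moreover have "f differentiable_on S"
    unfolding differentiable_on_def differentiable_def
    using has_derivative_at_withinI[OF assms(2)] by blast
  ultimately show ?thesis by simp
qed

lemma Ck_on_Suc_imp: "Ck_on (Suc k) S f \<Longrightarrow> Ck_on k S f"
  by (induction k arbitrary: f) (auto simp: differentiable_imp_continuous_on)

lemma Ck_on_imp_continuous_on: "Ck_on k S f \<Longrightarrow> continuous_on S f"
  by (cases k) (auto simp: differentiable_imp_continuous_on)

lemma Ck_on_subset: "T \<subseteq> S \<Longrightarrow> Ck_on k S f \<Longrightarrow> Ck_on k T f"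
  by (induction k arbitrary: f) (auto intro: continuous_on_subset differentiable_on_subset)

lemma Ck_on_local:
  assumes "\<And>x. x \<in> S \<Longrightarrow> \<exists>T. open T \<and> x \<in> T \<and> Ck_on k T f"
  shows "Ck_on k S f"
  using assms
proof (induction k arbitrary: f)
  case 0
  then have "continuous (at x within S) f" if "x \<in> S" for x
    using that by (metis Ck_on.simps(1) continuous_at_imp_continuous_at_within continuous_on_eq_continuous_at)
  then show ?case by (simp add: continuous_on_eq_continuous_within)
next
  case (Suc k)
  have "f differentiable (at x within S)" if x: "x \<in> S" for x
    using Suc.prems[OF x] Ck_on_has_derivative differentiableI differentiable_at_withinI by blast
  moreover have "Ck_on k S (\<lambda>x. frechet_derivative f (at x) v)" for v
  proof (rule Suc.IH)
    fix x
    assume "x \<in> S"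
    then obtain T where "open T" "x \<in> T" "Ck_on (Suc k) T f"
      using Suc.prems by blast
    then show "\<exists>T. open T \<and> x \<in> T \<and> Ck_on k T (\<lambda>x. frechet_derivative f (at x) v)"
      using Ck_on_SucD[of k T f v] by blast
  qed
  ultimately show ?case by (simp add: differentiable_on_def)
qed

lemma Ck_on_const: "open S \<Longrightarrow> Ck_on k S (\<lambda>x. c)"
proof (induction k arbitrary: c)
  case (Suc k)
  then show ?case by (intro Ck_on_Suc_intro[where f' = "\<lambda>_ _. 0"]) auto
qed simp

lemma Ck_on_add:
  assumes "open S" "Ck_on k S f" "Ck_on k S g"
  shows "Ck_on k S (\<lambda>x. f x + g x)"
  using assms(2,3)
proof (induction k arbitrary: f g)
  case 0
  then show ?case by (simp add: continuous_on_add)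
next
  case (Suc k)
  show ?case
    by (rule Ck_on_Suc_intro[OF \<open>open S\<close> has_derivative_add[OF
          Ck_on_has_derivative[OF \<open>open S\<close> Suc.prems(1)] Ck_on_has_derivative[OF \<open>open S\<close> Suc.prems(2)]]])
      (use Suc in auto)
qed

lemma Ck_on_mult:
  fixes f g :: "'a::euclidean_space \<Rightarrow> real"
  assumes "open S" "Ck_on k S f" "Ck_on k S g"
  shows "Ck_on k S (\<lambda>x. f x * g x)"
  using assms(2,3)
proof (induction k arbitrary: f g)
  case 0
  then show ?case by (simp add: continuous_on_mult)
next
  case (Suc k)
  show ?case
    by (rule Ck_on_Suc_intro[OF \<open>open S\<close> has_derivative_mult[OF
          Ck_on_has_derivative[OF \<open>open S\<close> Suc.prems(1)] Ck_on_has_derivative[OF \<open>open S\<close> Suc.prems(2)]]])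
      (assumption | intro Ck_on_add \<open>open S\<close> Suc.IH Ck_on_SucD[OF Suc.prems(1)]
        Ck_on_SucD[OF Suc.prems(2)] Ck_on_Suc_imp[OF Suc.prems(1)] Ck_on_Suc_imp[OF Suc.prems(2)])+
qed

lemma Ck_on_sum:
  assumes "open S" "finite I" "\<And>i. i \<in> I \<Longrightarrow> Ck_on k S (f i)"
  shows "Ck_on k S (\<lambda>x. \<Sum>i\<in>I. f i x)"
  using assms(2,3) by (induction I rule: finite_induct) (auto intro: Ck_on_const Ck_on_add assms(1))

lemma Ck_on_bounded_linear:
  assumes "bounded_linear L" "open S" "Ck_on k S f"
  shows "Ck_on k S (\<lambda>x. L (f x))"
  using assms(3)
proof (induction k arbitrary: f)
  case 0
  then show ?case using assms(1) by (simp add: bounded_linear.continuous_on)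
next
  case (Suc k)
  show ?case
    by (rule Ck_on_Suc_intro[OF \<open>open S\<close> bounded_linear.has_derivative[OF assms(1)
          Ck_on_has_derivative[OF \<open>open S\<close> Suc.prems(1)]]])
      (use Suc in auto)
qed

lemma Ck_on_ident: "open S \<Longrightarrow> Ck_on k S (\<lambda>x. x)"
  by (cases k) (auto intro!: Ck_on_Suc_intro[where f' = "\<lambda>_ v. v"] Ck_on_const)

lemma has_derivative_Basis:
  fixes f' :: "'a::euclidean_space \<Rightarrow> real"
  assumes "(f has_derivative f') F"
  shows "f' v = (\<Sum>b\<in>Basis. (v \<bullet> b) * f' b)"
proof -
  interpret linear f'
    by (rule has_derivative_linear[OF assms])
  have "f' v = f' (\<Sum>b\<in>Basis. (v \<bullet> b) *\<^sub>R b)"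
    by (simp only: euclidean_representation)
  also have "\<dots> = (\<Sum>b\<in>Basis. (v \<bullet> b) * f' b)"
    by (simp only: sum scale real_scaleR_def)
  finally show ?thesis .
qed

text \<open>\<open>Ck_on\<close> speaks of derivatives in a fixed direction, whereas in the chain
  rule the direction in which u is differentiated varies with x. Expanding that direction in the
  basis leaves sums of products of functions to which the induction applies.\<close>

lemma Ck_on_compose:
  fixes u :: "'b::euclidean_space \<Rightarrow> real" and \<tau> :: "'a::euclidean_space \<Rightarrow> 'b"
  assumes "open S" "open T" "\<tau> ` S \<subseteq> T" "Ck_on k S \<tau>" "Ck_on k T u"
  shows "Ck_on k S (\<lambda>x. u (\<tau> x))"
  using assms(4,5)
proof (induction k arbitrary: u)
  case 0
  then show ?case using assms(3) continuous_on_compose2[of T u S \<tau>] by auto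
next
  case (Suc k)
  let ?U = "\<lambda>y. frechet_derivative u (at y)" and ?T = "\<lambda>x. frechet_derivative \<tau> (at x)"
  have T: "\<tau> x \<in> T" if "x \<in> S" for x
    using assms(3) that by auto
  have "((\<lambda>x. u (\<tau> x)) has_derivative (\<lambda>v. \<Sum>b\<in>Basis. (?T x v \<bullet> b) * ?U (\<tau> x) b)) (at x)"
    if x: "x \<in> S" for x
  proof -
    have d: "(u has_derivative ?U (\<tau> x)) (at (\<tau> x))"
      by (rule Ck_on_has_derivative[OF assms(2) Suc.prems(2) T[OF x]])
    show ?thesis
      by (rule has_derivative_eq_rhs[OF
            has_derivative_compose[OF Ck_on_has_derivative[OF assms(1) Suc.prems(1) x] d]])
        (rule ext, rule has_derivative_Basis[OF d])
  qed
  then show ?case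
  proof (rule Ck_on_Suc_intro[OF \<open>open S\<close>])
    fix v
    show "Ck_on k S (\<lambda>x. \<Sum>b\<in>Basis. (?T x v \<bullet> b) * ?U (\<tau> x) b)"
      using Suc.prems Suc.IH[OF Ck_on_Suc_imp[OF Suc.prems(1)]]
      by (intro Ck_on_sum Ck_on_mult \<open>open S\<close> finite_Basis
          Ck_on_bounded_linear[OF bounded_linear_inner_left]) auto
  qed auto
qed

section \<open>Flat functions and bump functions\<close>

definition flat_exp :: "nat \<Rightarrow> real \<Rightarrow> real" where
  "flat_exp n x = (if x > 0 then exp (- inverse x) * inverse x ^ n else 0)"

lemma flat_exp_tendsto: "(flat_exp n \<longlongrightarrow> 0) (at 0)"
proof -
  have "((\<lambda>y::real. y ^ n / exp y) \<longlongrightarrow> 0) at_top"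
    by (rule tendsto_power_div_exp_0)
  then have "((\<lambda>x::real. inverse x ^ n / exp (inverse x)) \<longlongrightarrow> 0) (at_right 0)"
    by (rule filterlim_compose[OF _ filterlim_inverse_at_top_right])
  then have "(flat_exp n \<longlongrightarrow> 0) (at_right 0)"
    by (rule tendsto_cong[THEN iffD1, rotated])
      (auto simp: flat_exp_def exp_minus field_simps eventually_at_right_field intro!: exI[of _ 1])
  moreover have "(flat_exp n \<longlongrightarrow> 0) (at_left 0)"
    by (rule tendsto_eventually)
      (auto simp: flat_exp_def eventually_at_left_field intro!: exI[of _ "-1"])
  ultimately show ?thesis
    by (simp add: filterlim_split_at)
qed

text \<open>The powers of 1/x are carried along so that the family is closed under differentiation
  up to linear combinations; smoothness of all members then follows by one induction.\<close>

lemma flat_exp_has_field_derivative: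
  "(flat_exp n has_field_derivative flat_exp (n + 2) x - real n * flat_exp (n + 1) x) (at x)"
proof -
  consider "x > 0" | "x < 0" | "x = 0" by linarith
  then show ?thesis
  proof cases
    case 1
    have "((\<lambda>x. exp (- inverse x) * inverse x ^ n) has_field_derivative
        flat_exp (n + 2) x - real n * flat_exp (n + 1) x) (at x)"
    proof (rule DERIV_cong)
      show "((\<lambda>x. exp (- inverse x) * inverse x ^ n) has_field_derivative
          exp (- inverse x) * (inverse x)\<^sup>2 * inverse x ^ n
          + exp (- inverse x) * (real n * inverse x ^ (n - 1) * - ((inverse x)\<^sup>2))) (at x)"
        using 1 by (auto intro!: derivative_eq_intros simp: power2_eq_square)
    qed (use 1 in \<open>cases n; simp add: flat_exp_def power2_eq_square algebra_simps\<close>)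
    then show ?thesis
      by (rule has_field_derivative_transform_within_open[of _ _ _ "{0<..}"])
        (use 1 in \<open>auto simp: flat_exp_def\<close>)
  next
    case 2
    have "((\<lambda>x. 0) has_field_derivative 0) (at x)" by simp
    then have "(flat_exp n has_field_derivative 0) (at x)"
      by (rule has_field_derivative_transform_within_open[of _ _ _ "{..<0}"])
        (use 2 in \<open>auto simp: flat_exp_def\<close>)
    then show ?thesis using 2 by (simp add: flat_exp_def)
  next
    case 3
    \<comment> \<open>The difference quotient of \<open>flat_exp n\<close> at 0 is
      \<open>flat_exp (Suc n)\<close>.\<close>
    have "(flat_exp (Suc n) \<longlongrightarrow> 0) (at 0)" by (rule flat_exp_tendsto)
    then have "((\<lambda>h. (flat_exp n (0 + h) - flat_exp n 0) / h) \<longlongrightarrow> 0) (at 0)"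
      by (rule tendsto_cong[THEN iffD1, rotated]) (auto simp: flat_exp_def field_simps)
    then show ?thesis using 3 by (simp add: flat_exp_def DERIV_def)
  qed
qed

lemma Ck_on_flat_exp: "Ck_on k UNIV (flat_exp n)"
proof (induction k arbitrary: n)
  case 0
  show ?case
    using flat_exp_has_field_derivative DERIV_isCont
    by (metis Ck_on.simps(1) continuous_at_imp_continuous_on)
next
  case (Suc k)
  have "(flat_exp n has_derivative (\<lambda>v. flat_exp (n + 2) x * v + - real n * flat_exp (n + 1) x * v)) (at x)" for x
    by (rule has_derivative_eq_rhs[OF flat_exp_has_field_derivative[unfolded has_field_derivative_def]])
      (simp add: fun_eq_iff algebra_simps)
  then show ?case
    by (rule Ck_on_Suc_intro[OF open_UNIV])
      (intro Ck_on_add Ck_on_mult Suc.IH Ck_on_const open_UNIV)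
qed

text \<open>The squared distance is spelled out in coordinates so that smoothness follows from the
  sum and product rules alone.\<close>

definition bump :: "'a::euclidean_space \<Rightarrow> real \<Rightarrow> 'a \<Rightarrow> real" where
  "bump a R x = flat_exp 0 (R\<^sup>2 - (\<Sum>b\<in>Basis. ((x - a) \<bullet> b) * ((x - a) \<bullet> b)))"

lemma bump_pos_iff: "0 < R \<Longrightarrow> bump a R x > 0 \<longleftrightarrow> x \<in> ball a R"
proof -
  assume R: "0 < R"
  have "(\<Sum>b\<in>Basis. ((x - a) \<bullet> b) * ((x - a) \<bullet> b)) = (dist a x)\<^sup>2"
    by (metis dist_commute dist_norm euclidean_inner power2_norm_eq_inner)
  moreover have "R\<^sup>2 - (dist a x)\<^sup>2 > 0 \<longleftrightarrow> dist a x < R"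
    using R by (metis abs_of_nonneg abs_of_pos abs_square_less_1 diff_gt_0_iff_gt power2_less_imp_less
        less_eq_real_def power_strict_mono zero_le_dist zero_less_numeral)
  ultimately show ?thesis by (simp add: bump_def flat_exp_def)
qed

lemma bump_eq_0_iff: "0 < R \<Longrightarrow> bump a R x = 0 \<longleftrightarrow> x \<notin> ball a R"
  using bump_pos_iff[of R a x] by (auto simp: bump_def flat_exp_def split: if_splits)

lemma Ck_on_bump: "Ck_on k UNIV (bump a R)"
proof -
  have lin: "Ck_on k UNIV (\<lambda>x. (x - a) \<bullet> b)" for b
    using Ck_on_add[OF open_UNIV Ck_on_bounded_linear[OF bounded_linear_inner_left open_UNIV Ck_on_ident[OF open_UNIV]]
      Ck_on_const[OF open_UNIV], of k b "- (a \<bullet> b)"] by (simp add: inner_diff_left)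
  have "Ck_on k UNIV (\<lambda>x. R\<^sup>2 + - 1 * (\<Sum>b\<in>Basis. ((x - a) \<bullet> b) * ((x - a) \<bullet> b)))"
    by (intro Ck_on_add Ck_on_const Ck_on_mult Ck_on_sum lin open_UNIV finite_Basis)
  from Ck_on_compose[OF open_UNIV open_UNIV _ this Ck_on_flat_exp]
  show ?thesis unfolding bump_def by simp
qed

section \<open>Differentiation under the integral and Hadamard's lemma\<close>

lemma Ck_on_integral_segment:
  fixes u :: "'a::euclidean_space \<Rightarrow> real"
  assumes "convex S" "open S" "q \<in> S"
  shows "\<lbrakk>\<And>k. Ck_on k S u; continuous_on {0..1} w\<rbrakk> \<Longrightarrow>
    Ck_on k S (\<lambda>x. integral {0..1} (\<lambda>t. w t * u (q + t *\<^sub>R (x - q))))"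
\<comment> \<open>Differentiating in x replaces u by a partial derivative and w(t) by w(t) t; the
  arbitrary weight is what makes the induction close.\<close>
proof (induction k arbitrary: u w)
  have seg: "q + t *\<^sub>R (x - q) \<in> S" if "x \<in> S" "t \<in> {0..1}" for x t
    using convexD_alt[OF assms(1) assms(3) that(1), of t] that(2) by (simp add: algebra_simps)
  have pd: "((\<lambda>x. integral {0..1} (\<lambda>t. w t * u (q + t *\<^sub>R (x - q)))) has_derivative
      (\<lambda>v. integral {0..1} (\<lambda>t. (w t * t) * frechet_derivative u (at (q + t *\<^sub>R (x - q))) v))) (at x)"
    if u: "\<And>k. Ck_on k S u" and w: "continuous_on {0..1} w" and x: "x \<in> S" for u w x
  proof -
    let ?d = "\<lambda>b x t. frechet_derivative u (at (q + t *\<^sub>R (x - q))) b"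
    \<comment> \<open>The derivative in x as a bounded linear map, the form required by
      \<open>leibniz_rule\<close>. The basis expansion reduces its continuity to that of finitely
      many partial derivatives.\<close>
    define fx where "fx = (\<lambda>x t. \<Sum>b\<in>Basis. (w t * t * ?d b x t) *\<^sub>R blinfun_inner_left b)"
    have du: "(u has_derivative frechet_derivative u (at y)) (at y)" if "y \<in> S" for y
      by (rule Ck_on_has_derivative[OF assms(2) u that])
    have lin: "frechet_derivative u (at y) v = (\<Sum>b\<in>Basis. (v \<bullet> b) * frechet_derivative u (at y) b)"
      if "y \<in> S" for y v
      by (rule has_derivative_Basis[OF du[OF that]])
    have fx: "blinfun_apply (fx x t) v = (w t * t) * ?d v x t" if "x \<in> S" "t \<in> {0..1}" for x t v
      unfolding fx_def lin[OF seg[OF that], of v]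
      by (simp add: blinfun.sum_left blinfun.scaleR_left sum_distrib_left inner_commute mult_ac)
    have cseg: "continuous_on (S \<times> {0..1}) (\<lambda>(x, t). q + t *\<^sub>R (x - q))"
      by (auto simp: split_beta intro!: continuous_intros)
    have cd: "continuous_on (S \<times> {0..1}) (\<lambda>(x, t). ?d b x t)" for b
      using continuous_on_compose2[OF Ck_on_imp_continuous_on[OF Ck_on_SucD[OF u]] cseg] seg
      by (simp add: split_beta image_subset_iff)
    have cw: "continuous_on (S \<times> {0..1}) (\<lambda>(x, t). w t)"
      using continuous_on_compose2[OF w, of "S \<times> {0..1}" snd] by (auto simp: split_beta continuous_on_snd)
    have cfx: "continuous_on (S \<times> cbox 0 1) (\<lambda>(x, t). fx x t)"
      unfolding fx_def using cd cw by (auto simp: split_beta intro!: continuous_intros)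
    have int: "(\<lambda>t. w t * u (q + t *\<^sub>R (x - q))) integrable_on cbox 0 1" if "x \<in> S" for x
    proof (rule integrable_continuous, rule continuous_on_mult)
      show "continuous_on (cbox 0 1) (\<lambda>t. u (q + t *\<^sub>R (x - q)))"
        by (rule continuous_on_compose2[OF Ck_on_imp_continuous_on[OF u]])
          (use seg that in \<open>auto intro!: continuous_intros\<close>)
    qed (use w in simp)
    have "((\<lambda>x. integral (cbox 0 1) (\<lambda>t. w t * u (q + t *\<^sub>R (x - q)))) has_derivative
        integral (cbox 0 1) (fx x)) (at x within S)"
    proof (rule leibniz_rule[OF _ int cfx x assms(1)])
      fix y t
      assume y: "y \<in> S" and t: "t \<in> cbox 0 (1::real)"
      have "((\<lambda>x. w t * u (q + t *\<^sub>R (x - q))) has_derivative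
          (\<lambda>v. w t * frechet_derivative u (at (q + t *\<^sub>R (y - q))) (t *\<^sub>R v))) (at y within S)"
        by (rule has_derivative_mult_right[OF has_derivative_compose[OF _ du]])
          (use seg y t in \<open>auto intro!: derivative_eq_intros\<close>)
      moreover have "w t * frechet_derivative u (at (q + t *\<^sub>R (y - q))) (t *\<^sub>R v) = blinfun_apply (fx y t) v" for v
        using fx[OF y, of t v] t linear_scale[OF has_derivative_linear[OF du[OF seg[OF y, of t]]], of t v]
        by simp
      ultimately show "((\<lambda>x. w t * u (q + t *\<^sub>R (x - q))) has_derivative blinfun_apply (fx y t)) (at y within S)"
        by simp
    qed simp_all
    moreover have "blinfun_apply (integral (cbox 0 1) (fx x)) = (\<lambda>v. integral {0..1} (\<lambda>t. (w t * t) * ?d v x t))"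
    proof
      fix v
      have "fx x integrable_on cbox 0 1"
      proof (rule integrable_continuous)
        have "continuous_on (cbox 0 1) (\<lambda>t. (case (x, t) of (x, t) \<Rightarrow> fx x t))"
          by (rule continuous_on_compose2[OF cfx]) (use x in \<open>auto intro!: continuous_intros\<close>)
        then show "continuous_on (cbox 0 1) (fx x)" by simp
      qed
      from integral_linear[OF this blinfun.bounded_linear_left[of v]]
      have "blinfun_apply (integral (cbox 0 1) (fx x)) v = integral (cbox 0 1) (\<lambda>t. blinfun_apply (fx x t) v)"
        by (simp add: o_def)
      also have "\<dots> = integral (cbox 0 1) (\<lambda>t. (w t * t) * ?d v x t)"
        by (rule integral_cong) (use fx[OF x] in simp)
      finally show "blinfun_apply (integral (cbox 0 1) (fx x)) v = integral {0..1} (\<lambda>t. (w t * t) * ?d v x t)"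
        by simp
    qed
    ultimately show ?thesis
      using at_within_open[OF x assms(2)] by simp
  qed
  {
    case 0
    then show ?case
      using has_derivative_continuous[OF pd] by (simp add: continuous_at_imp_continuous_on)
  next
    case (Suc k)
    show ?case
    proof (rule Ck_on_Suc_intro[OF assms(2) pd[OF Suc.prems]])
      fix v
      show "Ck_on k S (\<lambda>x. integral {0..1} (\<lambda>t. w t * t * frechet_derivative u (at (q + t *\<^sub>R (x - q))) v))"
        by (rule Suc.IH) (use Suc.prems(2) Ck_on_SucD[OF Suc.prems(1)] in \<open>auto intro!: continuous_intros\<close>)
    qed
  }
qed

text \<open>Integrate the derivative of u along the segment from q to x: \<open>G b\<close> is the
  mean of the partial derivative in direction b. A derivation at q kills constants and sees each
  product only through the factor vanishing at q, so it becomes a combination of partial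
  derivatives.\<close>

lemma hadamard:
  fixes u :: "'a::euclidean_space \<Rightarrow> real"
  assumes "convex S" "open S" "q \<in> S" and u: "\<And>k. Ck_on k S u"
  obtains G where "\<And>b k. Ck_on k S (G b)"
    and "\<And>x. x \<in> S \<Longrightarrow> u x = u q + (\<Sum>b\<in>Basis. ((x - q) \<bullet> b) * G b x)"
    and "\<And>b. G b q = frechet_derivative u (at q) b"
proof
  \<comment> \<open>The factor 1 is the initial weight for
    \<open>Ck_on_integral_segment\<close>.\<close>
  let ?G = "\<lambda>b x. integral {0..1} (\<lambda>t. 1 * frechet_derivative u (at (q + t *\<^sub>R (x - q))) b)"
  show "Ck_on k S (?G b)" for b k
    by (rule Ck_on_integral_segment[OF assms(1-3)]) (use Ck_on_SucD[OF u] in auto)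
  show "?G b q = frechet_derivative u (at q) b" for b
    by simp
  fix x
  assume x: "x \<in> S"
  have seg: "q + t *\<^sub>R (x - q) \<in> S" if "t \<in> {0..1}" for t
    using convexD_alt[OF assms(1) assms(3) x, of t] that by (simp add: algebra_simps)
  have du: "(u has_derivative frechet_derivative u (at y)) (at y)" if "y \<in> S" for y
    by (rule Ck_on_has_derivative[OF assms(2) u that])
  have lin: "frechet_derivative u (at y) v = (\<Sum>b\<in>Basis. (v \<bullet> b) * frechet_derivative u (at y) b)"
    if "y \<in> S" for y v
    by (rule has_derivative_Basis[OF du[OF that]])
  have "((\<lambda>t. u (q + t *\<^sub>R (x - q))) has_vector_derivative
      (\<Sum>b\<in>Basis. ((x - q) \<bullet> b) * frechet_derivative u (at (q + t *\<^sub>R (x - q))) b)) (at t within {0..1})"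
    if t: "t \<in> {0..1}" for t
  proof -
    have "((\<lambda>t. u (q + t *\<^sub>R (x - q))) has_derivative
        (\<lambda>s. frechet_derivative u (at (q + t *\<^sub>R (x - q))) (s *\<^sub>R (x - q)))) (at t within {0..1})"
      by (rule has_derivative_compose[where g = u and f = "\<lambda>t. q + t *\<^sub>R (x - q)", OF _ du[OF seg[OF t]]])
        (auto intro!: derivative_eq_intros)
    then show ?thesis
      unfolding has_vector_derivative_def lin[OF seg[OF t], of "x - q", symmetric]
      by (simp add: linear_scale[OF has_derivative_linear[OF du[OF seg[OF t]]]])
  qed
  from fundamental_theorem_of_calculus[OF _ this]
  have "((\<lambda>t. \<Sum>b\<in>Basis. ((x - q) \<bullet> b) * frechet_derivative u (at (q + t *\<^sub>R (x - q))) b)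
      has_integral u x - u q) {0..1}" by simp
  moreover have "(\<lambda>t. frechet_derivative u (at (q + t *\<^sub>R (x - q))) b) integrable_on {0..1}" for b
    by (rule integrable_continuous_interval,
        rule continuous_on_compose2[OF Ck_on_imp_continuous_on[OF Ck_on_SucD[OF u]]])
      (use seg in \<open>auto intro!: continuous_intros\<close>)
  ultimately show "u x = u q + (\<Sum>b\<in>Basis. ((x - q) \<bullet> b) * ?G b x)"
    by (simp add: integral_sum[symmetric] integrable_on_mult_right integral_unique
        flip: integral_mult_right)
qed

section \<open>Local frames on manifolds\<close>

lemma sum_fun_apply: "(\<Sum>i\<in>I. f i) x = (\<Sum>i\<in>I. f i x)"
  by (induction I rule: infinite_finite_induct) auto

text \<open>Two radii are used because w is smooth only on the larger ball, while the bump already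
  vanishes outside the smaller one. The larger ball and the complement of the smaller closed ball
  are open and cover the space.\<close>

lemma Ck_on_cutoff:
  assumes "0 < R" "R < R'" "\<And>k. Ck_on k (ball a R') w"
  shows "Ck_on k UNIV (\<lambda>x. if x \<in> ball a R' then bump a R x * w x else 0)" (is "Ck_on k UNIV ?f")
proof (rule Ck_on_local)
  fix x
  show "\<exists>T. open T \<and> x \<in> T \<and> Ck_on k T ?f"
  proof (cases "x \<in> ball a R'")
    case True
    have "Ck_on k (ball a R') ?f"
      by (rule Ck_on_cong[of _ "\<lambda>x. bump a R x * w x"])
        (use assms(3) Ck_on_subset[OF _ Ck_on_bump] in \<open>auto intro!: Ck_on_mult\<close>)
    then show ?thesis using True open_ball by blast
  next
    case False
    have "Ck_on k (- cball a R) ?f"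
      by (rule Ck_on_cong[of _ "\<lambda>x. 0"]) (use assms(1) bump_eq_0_iff[of R a] in \<open>auto intro: Ck_on_const\<close>)
    then show ?thesis
      using False assms(2) by (intro exI[of _ "- cball a R"]) auto
  qed
qed

locale manifold =
  fixes A :: "('m::{t2_space,second_countable_topology}, 'e::euclidean_space) atlas"
  assumes smooth_atlas: "smooth_atlas A"
begin

abbreviation "SF \<equiv> smooth_functions A"
abbreviation "VF \<equiv> vector_fields A"

lemma chart_facts:
  assumes "(U, c) \<in> A"
  shows "open U" "open (c ` U)" "continuous_on U c" "continuous_on (c ` U) (inv_into U c)"
    "\<And>m. m \<in> U \<Longrightarrow> inv_into U c (c m) = m"
    "\<And>x. x \<in> c ` U \<Longrightarrow> inv_into U c x \<in> U" "\<And>x. x \<in> c ` U \<Longrightarrow> c (inv_into U c x) = x"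
  using assms smooth_atlas unfolding smooth_atlas_def chart_def homeomorphism_def by fastforce+

lemma chart_at: obtains U c where "(U, c) \<in> A" "p \<in> U"
proof -
  have "p \<in> (\<Union>(U, c)\<in>A. U)"
    using smooth_atlas by (simp add: smooth_atlas_def)
  then show ?thesis using that by auto
qed

lemma transition: "(U, c) \<in> A \<Longrightarrow> (V, d) \<in> A \<Longrightarrow> Ck_on k (c ` (U \<inter> V)) (d \<circ> inv_into U c)"
  using smooth_atlas unfolding smooth_atlas_def smooth_on_def by fast

lemma SF_I: "(\<And>U c k. (U, c) \<in> A \<Longrightarrow> Ck_on k (c ` U) (\<lambda>x. f (inv_into U c x))) \<Longrightarrow> f \<in> SF"
  unfolding smooth_functions_def smooth_on_def o_def by blast

lemma SF_D: "f \<in> SF \<Longrightarrow> (U, c) \<in> A \<Longrightarrow> Ck_on k (c ` U) (\<lambda>x. f (inv_into U c x))"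
  unfolding smooth_functions_def smooth_on_def o_def by blast

lemma SF_const [simp, intro]: "(\<lambda>_. a) \<in> SF"
  by (rule SF_I) (simp add: Ck_on_const chart_facts)

lemma SF_add [simp, intro]: "f \<in> SF \<Longrightarrow> g \<in> SF \<Longrightarrow> f + g \<in> SF"
  by (rule SF_I, simp only: plus_fun_apply, rule Ck_on_add) (simp_all add: SF_D chart_facts)

lemma SF_mult [simp, intro]: "f \<in> SF \<Longrightarrow> g \<in> SF \<Longrightarrow> f * g \<in> SF"
  by (rule SF_I, simp only: times_fun_apply, rule Ck_on_mult) (simp_all add: SF_D chart_facts)

lemma SF_cmult [simp, intro]: "f \<in> SF \<Longrightarrow> (\<lambda>x. a * f x) \<in> SF"
  using SF_mult[OF SF_const, of f a] by (simp add: times_fun_def)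

lemma SF_0 [simp, intro]: "0 \<in> SF" and SF_1 [simp, intro]: "1 \<in> SF"
  by (simp_all add: zero_fun_def one_fun_def)

lemma SF_numeral [simp, intro]: "numeral n \<in> SF"
  by (simp add: numeral_fun)

lemma SF_uminus [simp, intro]: "f \<in> SF \<Longrightarrow> - f \<in> SF"
  using SF_cmult[of f "-1"] by (simp add: fun_Compl_def)

lemma SF_diff [simp, intro]: "f \<in> SF \<Longrightarrow> g \<in> SF \<Longrightarrow> f - g \<in> SF"
  using SF_add[OF _ SF_uminus, of f g] by simp

lemma SF_sum: "(\<And>i. i \<in> I \<Longrightarrow> f i \<in> SF) \<Longrightarrow> (\<Sum>i\<in>I. f i) \<in> SF"
  by (induction I rule: infinite_finite_induct) auto

text \<open>Hausdorffness makes the support of a function compactly supported in a chart closed.\<close>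

lemma SF_extend:
  assumes chart: "(U, c) \<in> A" and K: "compact K" "K \<subseteq> c ` U"
    and u: "\<And>k. Ck_on k UNIV u" "\<And>x. x \<notin> K \<Longrightarrow> u x = 0"
  shows "(\<lambda>m. if m \<in> U then u (c m) else 0) \<in> SF" (is "?f \<in> SF")
proof (rule SF_I, rule Ck_on_local)
  fix V d k x
  assume V: "(V, d) \<in> A" and x: "x \<in> d ` V"
  let ?i = "inv_into V d"
  note V_facts = chart_facts[OF V]
  have im: "d ` (V \<inter> W) = d ` V \<inter> ?i -` W" for W
    using V_facts(5-7) by (auto simp: image_iff)
  have op: "open (d ` (V \<inter> W))" if "open W" for W
    unfolding im by (rule continuous_open_preimage[OF V_facts(4,2) that])
  show "\<exists>T. open T \<and> x \<in> T \<and> Ck_on k T (\<lambda>y. ?f (?i y))"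
  proof (cases "?i x \<in> U")
    case True
    have "Ck_on k (d ` (V \<inter> U)) (\<lambda>y. ?f (?i y))"
    proof (rule Ck_on_cong[OF op[OF chart_facts(1)[OF chart]]])
      show "Ck_on k (d ` (V \<inter> U)) (\<lambda>y. u ((c \<circ> ?i) y))"
        by (rule Ck_on_compose[OF op[OF chart_facts(1)[OF chart]] open_UNIV _ transition[OF V chart] u(1)])
          simp
    qed (auto simp: V_facts)
    then show ?thesis using True op[OF chart_facts(1)[OF chart]] x im by auto
  next
    case False
    let ?K = "inv_into U c ` K"
    have "compact ?K"
      using K by (intro compact_continuous_image continuous_on_subset[OF chart_facts(4)[OF chart]])
    then have o: "open (- ?K)" by (simp add: compact_imp_closed open_Compl)
    have "Ck_on k (d ` (V \<inter> - ?K)) (\<lambda>y. ?f (?i y))"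
    proof (rule Ck_on_cong[OF op[OF o] _ Ck_on_const[OF op[OF o]]])
      fix y
      assume "y \<in> d ` (V \<inter> - ?K)"
      then have "?i y \<notin> ?K" using im by auto
      then have "u (c (?i y)) = 0" if "?i y \<in> U"
        using u(2)[of "c (?i y)"] chart_facts(5)[OF chart that] by (metis imageI)
      then show "0 = ?f (?i y)" by auto
    qed
    moreover have "?i x \<notin> ?K"
      using False K(2) chart_facts(6)[OF chart] by auto
    ultimately show ?thesis
      using op[OF o] x by (intro exI[of _ "d ` (V \<inter> - ?K)"]) (auto simp: im)
  qed
qed

section \<open>Tangent vectors, vector fields and one-forms\<close>

lemma tangentD:
  assumes "v \<in> tangent_space A p"
  shows "f \<notin> SF \<Longrightarrow> v f = 0" "f \<in> SF \<Longrightarrow> v (\<lambda>x. a * f x) = a * v f"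
    "f \<in> SF \<Longrightarrow> k \<in> SF \<Longrightarrow> v (f + k) = v f + v k"
    "f \<in> SF \<Longrightarrow> k \<in> SF \<Longrightarrow> v (f * k) = f p * v k + k p * v f"
  using assms unfolding tangent_space_def by auto

lemma VF_D: "X \<in> VF \<Longrightarrow> X p \<in> tangent_space A p"
  and vapply_SF [simp, intro]: "X \<in> VF \<Longrightarrow> f \<in> SF \<Longrightarrow> X \<bullet>\<^sub>v f \<in> SF"
  unfolding vector_fields_def vapply_def by auto

lemma VF_add [simp, intro]: "X \<in> VF \<Longrightarrow> Y \<in> VF \<Longrightarrow> X + Y \<in> VF"
proof -
  assume XY: "X \<in> VF" "Y \<in> VF"
  have "(\<lambda>p. X p f + Y p f) \<in> SF" if "f \<in> SF" for f
    using SF_add[OF vapply_SF[OF XY(1) that] vapply_SF[OF XY(2) that]]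
    by (simp add: vapply_def plus_fun_def)
  then show ?thesis
    using tangentD[OF VF_D[OF XY(1)]] tangentD[OF VF_D[OF XY(2)]]
    by (simp add: vector_fields_def tangent_space_def algebra_simps)
qed

lemma VF_scale [simp, intro]: "f \<in> SF \<Longrightarrow> X \<in> VF \<Longrightarrow> f \<odot> X \<in> VF"
proof -
  assume f: "f \<in> SF" and X: "X \<in> VF"
  have "(\<lambda>p. f p * X p k) \<in> SF" if "k \<in> SF" for k
    using SF_mult[OF f vapply_SF[OF X that]] by (simp add: vapply_def times_fun_def)
  then show ?thesis
    using tangentD[OF VF_D[OF X]]
    by (simp add: vector_fields_def tangent_space_def fscale_def algebra_simps)
qed

lemma VF_0 [simp, intro]: "0 \<in> VF"
  by (simp add: vector_fields_def tangent_space_def flip: zero_fun_def)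

lemma VF_uminus [simp, intro]: "X \<in> VF \<Longrightarrow> - X \<in> VF"
  using VF_scale[OF SF_const, of X "-1"] by (simp add: fscale_def fun_Compl_def)

lemma VF_diff [simp, intro]: "X \<in> VF \<Longrightarrow> Y \<in> VF \<Longrightarrow> X - Y \<in> VF"
  using VF_add[OF _ VF_uminus, of X Y] by simp

lemma VF_sum: "(\<And>i. i \<in> I \<Longrightarrow> X i \<in> VF) \<Longrightarrow> (\<Sum>i\<in>I. X i) \<in> VF"
  by (induction I rule: infinite_finite_induct) auto

lemma vapply_add: "X \<in> VF \<Longrightarrow> f \<in> SF \<Longrightarrow> g \<in> SF \<Longrightarrow> X \<bullet>\<^sub>v (f + g) = X \<bullet>\<^sub>v f + X \<bullet>\<^sub>v g"
  using tangentD(3)[OF VF_D] by (fastforce simp: vapply_def)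

lemma vapply_mult: "X \<in> VF \<Longrightarrow> f \<in> SF \<Longrightarrow> g \<in> SF \<Longrightarrow> X \<bullet>\<^sub>v (f * g) = f * X \<bullet>\<^sub>v g + g * X \<bullet>\<^sub>v f"
  using tangentD(4)[OF VF_D] by (fastforce simp: vapply_def)

lemma vapply_cmult: "X \<in> VF \<Longrightarrow> f \<in> SF \<Longrightarrow> X \<bullet>\<^sub>v (\<lambda>x. a * f x) = (\<lambda>x. a * (X \<bullet>\<^sub>v f) x)"
  using tangentD(2)[OF VF_D] by (fastforce simp: vapply_def)

lemma vapply_uminus: "X \<in> VF \<Longrightarrow> f \<in> SF \<Longrightarrow> X \<bullet>\<^sub>v (- f) = - (X \<bullet>\<^sub>v f)"
  using vapply_cmult[of X f "-1"] by (simp add: fun_Compl_def)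

lemma vapply_diff: "X \<in> VF \<Longrightarrow> f \<in> SF \<Longrightarrow> g \<in> SF \<Longrightarrow> X \<bullet>\<^sub>v (f - g) = X \<bullet>\<^sub>v f - X \<bullet>\<^sub>v g"
  using vapply_add[of X f "- g"] vapply_uminus[of X g] by simp

lemma vapply_one: "X \<in> VF \<Longrightarrow> X \<bullet>\<^sub>v 1 = 0"
  using vapply_mult[of X 1 1] by simp

lemma vapply_const: "X \<in> VF \<Longrightarrow> X \<bullet>\<^sub>v (\<lambda>_. a) = 0"
  using vapply_cmult[of X 1 a] vapply_one[of X] by (simp add: zero_fun_def one_fun_def)

lemma vapply_0 [simp]: "X \<in> VF \<Longrightarrow> X \<bullet>\<^sub>v 0 = 0"
  using vapply_const[of X 0] by (simp add: zero_fun_def)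

lemma vapply_sum:
  "X \<in> VF \<Longrightarrow> (\<And>i. i \<in> I \<Longrightarrow> f i \<in> SF) \<Longrightarrow> X \<bullet>\<^sub>v (\<Sum>i\<in>I. f i) = (\<Sum>i\<in>I. X \<bullet>\<^sub>v f i)"
  by (induction I rule: infinite_finite_induct) (auto simp: vapply_add SF_sum)

lemma one_formD:
  assumes "one_form A \<alpha>"
  shows "X \<in> VF \<Longrightarrow> \<alpha> X \<in> SF" "X \<in> VF \<Longrightarrow> Y \<in> VF \<Longrightarrow> \<alpha> (X + Y) = \<alpha> X + \<alpha> Y"
    "f \<in> SF \<Longrightarrow> X \<in> VF \<Longrightarrow> \<alpha> (f \<odot> X) = f * \<alpha> X"
  using assms by (auto simp: one_form_def)

lemma one_form_0: "one_form A \<alpha> \<Longrightarrow> \<alpha> 0 = 0"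
  using one_formD(2)[of \<alpha> 0 0] by simp

lemma one_form_sum:
  assumes "one_form A \<alpha>" "\<And>i. i \<in> I \<Longrightarrow> f i \<in> SF" "\<And>i. i \<in> I \<Longrightarrow> X i \<in> VF"
  shows "\<alpha> (\<Sum>i\<in>I. f i \<odot> X i) = (\<Sum>i\<in>I. f i * \<alpha> (X i))"
  using assms(2,3)
proof (induction I rule: infinite_finite_induct)
  case (insert i I)
  have "\<alpha> (\<Sum>i\<in>insert i I. f i \<odot> X i) = \<alpha> (f i \<odot> X i + (\<Sum>i\<in>I. f i \<odot> X i))"
    by (simp only: sum.insert[OF insert(1,2)])
  also have "\<dots> = \<alpha> (f i \<odot> X i) + \<alpha> (\<Sum>i\<in>I. f i \<odot> X i)"
    by (rule one_formD(2)[OF assms(1)]) (auto intro!: VF_scale VF_sum insert.prems)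
  also have "\<dots> = f i * \<alpha> (X i) + (\<Sum>i\<in>I. f i * \<alpha> (X i))"
    by (simp only: insert.IH insert.prems insertI1 insertI2 one_formD(3)[OF assms(1)])
  finally show ?case by (simp only: sum.insert[OF insert(1,2)])
qed (simp_all add: one_form_0[OF assms(1)])

text \<open>The coefficients are those of \<open>W\<close> in the chart coordinates, with the cutoff \<open>\<rho>\<close> making all
  objects global: up to powers of \<open>\<rho>\<close>, \<open>x b\<close> is \<open>\<rho>\<close> times a coordinate and \<open>E b\<close> is \<open>\<rho>\<close> times a
  coordinate vector field.\<close>

lemma local_frame:
  obtains \<rho> :: "'m \<Rightarrow> real" and x and E :: "'e \<Rightarrow> 'm vfield"
  where "\<rho> \<in> SF" "\<rho> p > 0" "\<And>b. x b \<in> SF" "\<And>b. E b \<in> VF"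
    "\<And>W. W \<in> VF \<Longrightarrow>
      (\<rho> * \<rho> * \<rho>) \<odot> W = (\<Sum>b\<in>Basis. (\<rho> * W \<bullet>\<^sub>v x b - x b * W \<bullet>\<^sub>v \<rho>) \<odot> E b)"
proof -
  obtain U c where chart: "(U, c) \<in> A" and p: "p \<in> U" by (rule chart_at)
  note c = chart_facts[OF chart]
  define a where "a = c p"
  obtain R' where R': "R' > 0" "cball a R' \<subseteq> c ` U"
    using c(2) p unfolding a_def open_contains_cball by blast
  define R where "R = R' / 2"
  have R: "0 < R" "R < R'" using R' by (simp_all add: R_def)
  let ?S = "ball a R'" and ?i = "inv_into U c"
  have S: "?S \<subseteq> c ` U" using R' ball_subset_cball by blast
  \<comment> \<open>With the bump factor built in, any function smooth on the ball yields a smooth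
    function on the whole manifold.\<close>
  define L where "L w = (\<lambda>m. if m \<in> U \<and> c m \<in> ?S then bump a R (c m) * w (c m) else 0)" for w
  have L: "L w \<in> SF" if "\<And>k. Ck_on k ?S w" for w
  proof -
    have "(\<lambda>m. if m \<in> U then (\<lambda>x. if x \<in> ?S then bump a R x * w x else 0) (c m) else 0) \<in> SF"
      by (rule SF_extend[OF chart _ R'(2) Ck_on_cutoff[OF R that]]) auto
    then show ?thesis
      by (rule back_subst[where P = "\<lambda>f. f \<in> SF"]) (auto simp: L_def)
  qed
  define \<rho> where "\<rho> = L (\<lambda>_. 1)"
  define x where "x b = L (\<lambda>y. y \<bullet> b)" for b
  let ?d = "\<lambda>f b y. frechet_derivative (\<lambda>y. f (?i y)) (at y) b"
  define E where "E b = (\<lambda>m f. if f \<in> SF then L (?d f b) m else 0)" for b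
  have CkS: "Ck_on k ?S (\<lambda>y. f (?i y))" if "f \<in> SF" for f k
    by (rule Ck_on_subset[OF S SF_D[OF that chart]])
  have df: "((\<lambda>y. f (?i y)) has_derivative (\<lambda>b. ?d f b y)) (at y)" if "f \<in> SF" "y \<in> ?S" for f y
    by (rule Ck_on_has_derivative[OF open_ball CkS[OF that(1)] that(2)])
  have \<rho>: "\<rho> \<in> SF" unfolding \<rho>_def by (intro L Ck_on_const open_ball)
  have x: "x b \<in> SF" for b
    unfolding x_def by (intro L Ck_on_bounded_linear[OF bounded_linear_inner_left] Ck_on_ident open_ball)
  have E: "E b \<in> VF" for b
  proof -
    have "L (?d (\<lambda>x. r * f x) b) m = r * L (?d f b) m" if "f \<in> SF" for f r m
      using frechet_derivative_at[OF has_derivative_mult_right[OF df[OF that], of "c m" r]]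
      by (auto simp: L_def fun_eq_iff)
    moreover have "L (?d (f + g) b) m = L (?d f b) m + L (?d g b) m" if "f \<in> SF" "g \<in> SF" for f g m
      using frechet_derivative_at[OF has_derivative_add[OF df[OF that(1)] df[OF that(2)], of "c m"]]
      by (auto simp: L_def fun_eq_iff simp flip: distrib_left)
    moreover have "L (?d (f * g) b) m = f m * L (?d g b) m + g m * L (?d f b) m"
      if "f \<in> SF" "g \<in> SF" for f g m
    proof (cases "m \<in> U \<and> c m \<in> ?S")
      case True
      then have "?d (f * g) b (c m) = f m * ?d g b (c m) + g m * ?d f b (c m)"
        using fun_cong[OF frechet_derivative_at[OF
              has_derivative_mult[OF df[OF that(1)] df[OF that(2)], of "c m"]], of b]
        by (simp add: c mult.commute[of "g m"])
      then show ?thesis using True by (simp only: L_def if_True) (simp add: algebra_simps)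
    qed (auto simp: L_def)
    moreover have "L (?d f b) \<in> SF" if "f \<in> SF" for f
      by (intro L Ck_on_SucD CkS that)
    ultimately show ?thesis
      by (simp add: vector_fields_def tangent_space_def E_def)
  qed
  have main: "\<rho> q * \<rho> q * \<rho> q * W q f
      = (\<Sum>b\<in>Basis. (\<rho> q * (W \<bullet>\<^sub>v x b) q - x b q * (W \<bullet>\<^sub>v \<rho>) q) * E b q f)" if W: "W \<in> VF" for W q f
  proof (cases "f \<in> SF \<and> q \<in> U \<and> c q \<in> ?S")
    case False
    then have "E b q f = 0" for b
      by (auto simp: E_def L_def)
    moreover have "\<rho> q * W q f = 0"
      using False tangentD(1)[OF VF_D[OF W]] by (auto simp: \<rho>_def L_def)
    ultimately show ?thesis by simp
  next
    case True
    then have f: "f \<in> SF" and q: "q \<in> U" "c q \<in> ?S" by auto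
    obtain G where G: "\<And>b k. Ck_on k ?S (G b)"
      "\<And>y. y \<in> ?S \<Longrightarrow> f (?i y) = f (?i (c q)) + (\<Sum>b\<in>Basis. ((y - c q) \<bullet> b) * G b y)"
      "\<And>b. G b (c q) = ?d f b (c q)"
      using hadamard[OF convex_ball open_ball q(2) CkS[OF f]] by blast
    \<comment> \<open>\<rho> times the coordinate centred at q. It vanishes at q, so in W(P b * L (G
      b)) only the term with W(P b) survives there.\<close>
    define P where "P b = x b - (\<lambda>m. (c q \<bullet> b) * \<rho> m)" for b
    have P: "P b \<in> SF" "P b q = 0" for b
      using x \<rho> q by (auto simp: P_def) (simp add: x_def \<rho>_def L_def)
    have xq: "x b q = \<rho> q * (c q \<bullet> b)" for b
      using q by (simp add: x_def \<rho>_def L_def)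
    have WP: "(W \<bullet>\<^sub>v P b) q = (W \<bullet>\<^sub>v x b) q - (c q \<bullet> b) * (W \<bullet>\<^sub>v \<rho>) q" for b
      using W x \<rho> by (simp add: P_def vapply_diff vapply_cmult)
    \<comment> \<open>Hadamard's expansion made global: one factor \<rho> is absorbed by the centred
      coordinates, the other by \<open>L (G b)\<close>.\<close>
    have "\<rho> * (\<rho> * (f - (\<lambda>_. f q))) = (\<Sum>b\<in>Basis. P b * L (G b))"
    proof
      fix m
      show "(\<rho> * (\<rho> * (f - (\<lambda>_. f q)))) m = (\<Sum>b\<in>Basis. P b * L (G b)) m"
      proof (cases "m \<in> U \<and> c m \<in> ?S")
        case True
        then have "f m - f q = (\<Sum>b\<in>Basis. ((c m - c q) \<bullet> b) * G b (c m))"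
          using G(2)[of "c m"] q c by simp
        then show ?thesis
          using True by (simp add: sum_fun_apply P_def x_def \<rho>_def L_def sum_distrib_left
              inner_diff_left algebra_simps)
      qed (auto simp: sum_fun_apply \<rho>_def L_def)
    qed
    then have "(W \<bullet>\<^sub>v (\<rho> * (\<rho> * (f - (\<lambda>_. f q))))) q = (W \<bullet>\<^sub>v (\<Sum>b\<in>Basis. P b * L (G b))) q"
      by simp
    moreover have "(W \<bullet>\<^sub>v (\<rho> * (\<rho> * (f - (\<lambda>_. f q))))) q = \<rho> q * \<rho> q * W q f"
      using W f \<rho> by (simp add: vapply_mult vapply_diff vapply_const) (simp add: vapply_def)
    moreover have "(W \<bullet>\<^sub>v (\<Sum>b\<in>Basis. P b * L (G b))) q = (\<Sum>b\<in>Basis. L (G b) q * (W \<bullet>\<^sub>v P b) q)"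
      using W P L[OF G(1)] by (simp add: vapply_sum vapply_mult sum_fun_apply)
    moreover have "L (G b) q = E b q f" for b
      using f q by (simp add: L_def E_def G(3))
    ultimately have "\<rho> q * \<rho> q * W q f
        = (\<Sum>b\<in>Basis. E b q f * ((W \<bullet>\<^sub>v x b) q - (c q \<bullet> b) * (W \<bullet>\<^sub>v \<rho>) q))"
      by (simp add: WP)
    \<comment> \<open>The third factor \<rho> turns the coordinates of q, which depend on the chart,
      into \<open>x b q\<close>.\<close>
    then have "\<rho> q * \<rho> q * \<rho> q * W q f
        = \<rho> q * (\<Sum>b\<in>Basis. E b q f * ((W \<bullet>\<^sub>v x b) q - (c q \<bullet> b) * (W \<bullet>\<^sub>v \<rho>) q))"
      by (simp only: mult.assoc)
    also have "\<dots> = (\<Sum>b\<in>Basis. (\<rho> q * (W \<bullet>\<^sub>v x b) q - x b q * (W \<bullet>\<^sub>v \<rho>) q) * E b q f)"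
      unfolding sum_distrib_left by (rule sum.cong) (simp_all add: xq algebra_simps)
    finally show ?thesis .
  qed
  have "\<rho> p > 0"
    using p R R' bump_pos_iff[of R a a] by (simp add: \<rho>_def L_def a_def)
  moreover have "(\<rho> * \<rho> * \<rho>) \<odot> W = (\<Sum>b\<in>Basis. (\<rho> * W \<bullet>\<^sub>v x b - x b * W \<bullet>\<^sub>v \<rho>) \<odot> E b)"
    if "W \<in> VF" for W
    using main[OF that] by (intro ext) (simp add: fscale_def sum_fun_apply)
  ultimately show ?thesis using that \<rho> x E by blast
qed

text \<open>The coefficients in \<open>local_frame\<close> at p, that is, \<rho>(p)^2 times the
  chart coordinates of X p. They depend on the derivation X p only, and since \<rho>(p) > 0 they
  control the value of every one-form at p; so the dimension of the model space bounds that of the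
  tangent space.\<close>

lemma tangent_coordinates:
  obtains w :: "'m vfield \<Rightarrow> 'e"
  where "\<And>X Y. X \<in> VF \<Longrightarrow> Y \<in> VF \<Longrightarrow> w (X + Y) = w X + w Y"
    and "\<And>f X. f \<in> SF \<Longrightarrow> X \<in> VF \<Longrightarrow> w (f \<odot> X) = f p *\<^sub>R w X"
    and "\<And>X. X p = 0 \<Longrightarrow> w X = 0"
    and "\<And>X. X \<in> VF \<Longrightarrow> w X = 0 \<Longrightarrow> \<forall>\<alpha>. one_form A \<alpha> \<longrightarrow> \<alpha> X p = 0"
proof -
  obtain \<rho> x E where fr: "\<rho> \<in> SF" "\<rho> p > 0" "\<And>b. x b \<in> SF" "\<And>b::'e. E b \<in> VF"
    "\<And>W. W \<in> VF \<Longrightarrow>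
      (\<rho> * \<rho> * \<rho>) \<odot> W = (\<Sum>b\<in>Basis. (\<rho> * W \<bullet>\<^sub>v x b - x b * W \<bullet>\<^sub>v \<rho>) \<odot> E b)"
    by (rule local_frame[of p]) (rule that)
  define w where "w W = (\<Sum>b\<in>Basis. (\<rho> p * W p (x b) - x b p * W p \<rho>) *\<^sub>R b)" for W :: "'m vfield"
  show ?thesis
  proof (rule that[of w])
    show "w (X + Y) = w X + w Y" for X Y
      by (simp add: w_def distrib_left scaleR_add_left scaleR_left_diff_distrib sum.distrib sum_subtractf)
    show "w (f \<odot> X) = f p *\<^sub>R w X" for f X
      unfolding w_def scaleR_sum_right scaleR_scaleR
      by (rule sum.cong) (auto simp: fscale_def right_diff_distrib mult.left_commute)
    show "w X = 0" if "X p = 0" for X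
      by (simp add: w_def that)
    fix X
    assume X: "X \<in> VF" and w: "w X = 0"
    have coeff: "\<rho> p * X p (x b) - x b p * X p \<rho> = 0" if "b \<in> Basis" for b
    proof -
      have "w X \<bullet> b = \<rho> p * X p (x b) - x b p * X p \<rho>"
        unfolding w_def by (rule inner_sum_left_Basis[OF that])
      then show ?thesis by (simp add: w)
    qed
    show "\<forall>\<alpha>. one_form A \<alpha> \<longrightarrow> \<alpha> X p = 0"
    proof (intro allI impI)
      fix \<alpha>
      assume \<alpha>: "one_form A \<alpha>"
      have *: "\<alpha> ((\<rho> * \<rho> * \<rho>) \<odot> X) p = (\<Sum>b\<in>Basis. (\<rho> * X \<bullet>\<^sub>v x b - x b * X \<bullet>\<^sub>v \<rho>) * \<alpha> (E b)) p"
        unfolding fr(5)[OF X]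
        by (subst one_form_sum[OF \<alpha>])
          (simp_all only: SF_diff SF_mult fr(1,3,4) X vapply_SF)
      have "\<alpha> ((\<rho> * \<rho> * \<rho>) \<odot> X) p = 0"
        unfolding * sum_fun_apply by (rule sum.neutral) (simp add: coeff vapply_def)
      then have "\<rho> p * \<rho> p * \<rho> p * \<alpha> X p = 0"
        unfolding one_formD(3)[OF \<alpha> SF_mult[OF SF_mult[OF fr(1) fr(1)] fr(1)] X] times_fun_apply .
      then show "\<alpha> X p = 0"
        using fr(2) by auto
    qed
  qed
qed

lemma one_form_pointwise: "one_form A \<alpha> \<Longrightarrow> X \<in> VF \<Longrightarrow> X p = 0 \<Longrightarrow> \<alpha> X p = 0"
proof (rule tangent_coordinates[of p])
  fix w :: "'m vfield \<Rightarrow> 'e"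
  assume \<alpha>: "one_form A \<alpha>" and X: "X \<in> VF" "X p = 0"
    and w: "\<And>X. X p = 0 \<Longrightarrow> w X = 0"
      "\<And>X. X \<in> VF \<Longrightarrow> w X = 0 \<Longrightarrow> \<forall>\<alpha>. one_form A \<alpha> \<longrightarrow> \<alpha> X p = 0"
  show "\<alpha> X p = 0"
    using w(2)[OF X(1) w(1)[of X, OF X(2)]] \<alpha> by blast
qed

lemma endo_fieldD:
  assumes "endo_field A \<psi>"
  shows "X \<in> VF \<Longrightarrow> \<psi> X \<in> VF" "X \<in> VF \<Longrightarrow> Y \<in> VF \<Longrightarrow> \<psi> (X + Y) = \<psi> X + \<psi> Y"
    "f \<in> SF \<Longrightarrow> X \<in> VF \<Longrightarrow> \<psi> (f \<odot> X) = f \<odot> \<psi> X"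
  using assms by (auto simp: endo_field_def)

lemma fscale_minus1: "(\<lambda>_. - 1) \<odot> X = - X"
  by (intro ext) (simp add: fscale_def)

lemma fscale_0 [simp]: "0 \<odot> X = 0" "f \<odot> 0 = 0"
  by (intro ext; simp add: fscale_def)+

lemma endo_field_uminus: "endo_field A \<psi> \<Longrightarrow> X \<in> VF \<Longrightarrow> \<psi> (- X) = - \<psi> X"
  using endo_fieldD(3)[of \<psi> "\<lambda>_. - 1" X] by (simp add: fscale_minus1)

lemma endo_field_diff: "endo_field A \<psi> \<Longrightarrow> X \<in> VF \<Longrightarrow> Y \<in> VF \<Longrightarrow> \<psi> (X - Y) = \<psi> X - \<psi> Y"
  using endo_fieldD(2)[of \<psi> X "- Y"] endo_field_uminus[of \<psi> Y] by simp

lemma endo_field_0: "endo_field A \<psi> \<Longrightarrow> \<psi> 0 = 0"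
  using endo_fieldD(2)[of \<psi> 0 0] by simp

lemmas endo_field_simps = endo_fieldD endo_field_uminus endo_field_diff endo_field_0

lemma endo_field_minus:
  "endo_field A \<psi> \<Longrightarrow> endo_field A \<psi>' \<Longrightarrow> endo_field A (\<lambda>X. \<psi> X - \<psi>' X)"
  unfolding endo_field_def by (simp add: algebra_simps) (intro ballI ext, simp add: fscale_def algebra_simps)

lemma endo_field_scale: "endo_field A \<psi> \<Longrightarrow> endo_field A (\<lambda>X. a \<odot>\<^sub>R \<psi> X)"
  unfolding endo_field_def by (auto; intro ext, simp add: fscale_def algebra_simps)

lemma endo_field_add: "endo_field A \<psi> \<Longrightarrow> endo_field A \<psi>' \<Longrightarrow> endo_field A (\<lambda>X. \<psi> X + \<psi>' X)"
  unfolding endo_field_def by (auto; intro ext, simp add: fscale_def algebra_simps)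

lemma endo_field_compose: "endo_field A \<psi> \<Longrightarrow> endo_field A \<psi>' \<Longrightarrow> endo_field A (\<lambda>X. \<psi> (\<psi>' X))"
  unfolding endo_field_def by simp

lemma one_form_uminus: "one_form A \<alpha> \<Longrightarrow> X \<in> VF \<Longrightarrow> \<alpha> (- X) = - \<alpha> X"
  using one_formD(3)[of \<alpha> "\<lambda>_. - 1" X] by (simp add: fscale_minus1 fun_eq_iff)

lemma one_form_diff: "one_form A \<alpha> \<Longrightarrow> X \<in> VF \<Longrightarrow> Y \<in> VF \<Longrightarrow> \<alpha> (X - Y) = \<alpha> X - \<alpha> Y"
  using one_formD(2)[of \<alpha> X "- Y"] one_form_uminus[of \<alpha> Y] by simp

lemmas one_form_simps = one_formD one_form_uminus one_form_diff one_form_0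

end

section \<open>Metric connections\<close>

locale metric_connection = manifold A
  for A :: "('m::{t2_space,second_countable_topology}, 'e::euclidean_space) atlas" +
  fixes g :: "'m form2" and D :: "'m connection"
  assumes metric: "riemannian_metric A g"
    and connection: "affine_connection A D"
    and parallel_metric: "parallel_form2 A D g"
begin

lemma g_form: "X \<in> VF \<Longrightarrow> one_form A (g X)"
  using metric by (simp add: riemannian_metric_def)

lemma g_sym: "X \<in> VF \<Longrightarrow> Y \<in> VF \<Longrightarrow> g X Y = g Y X"
  using metric by (simp add: riemannian_metric_def)

lemma g_form':
  assumes "Y \<in> VF"
  shows "one_form A (\<lambda>X. g X Y)"
  using g_form[OF assms] assms by (simp add: one_form_def g_sym)

lemma g_SF [simp]: "X \<in> VF \<Longrightarrow> Y \<in> VF \<Longrightarrow> g X Y \<in> SF"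
  by (rule one_formD(1)[OF g_form])

lemma g_simps [simp]:
  "X \<in> VF \<Longrightarrow> Y \<in> VF \<Longrightarrow> Z \<in> VF \<Longrightarrow> g X (Y + Z) = g X Y + g X Z"
  "X \<in> VF \<Longrightarrow> Y \<in> VF \<Longrightarrow> Z \<in> VF \<Longrightarrow> g X (Y - Z) = g X Y - g X Z"
  "X \<in> VF \<Longrightarrow> Y \<in> VF \<Longrightarrow> g X (- Y) = - g X Y"
  "X \<in> VF \<Longrightarrow> Y \<in> VF \<Longrightarrow> f \<in> SF \<Longrightarrow> g X (f \<odot> Y) = f * g X Y"
  "X \<in> VF \<Longrightarrow> g X 0 = 0"
  "X \<in> VF \<Longrightarrow> Y \<in> VF \<Longrightarrow> Z \<in> VF \<Longrightarrow> g (Y + Z) X = g Y X + g Z X"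
  "X \<in> VF \<Longrightarrow> Y \<in> VF \<Longrightarrow> Z \<in> VF \<Longrightarrow> g (Y - Z) X = g Y X - g Z X"
  "X \<in> VF \<Longrightarrow> Y \<in> VF \<Longrightarrow> g (- Y) X = - g Y X"
  "X \<in> VF \<Longrightarrow> Y \<in> VF \<Longrightarrow> f \<in> SF \<Longrightarrow> g (f \<odot> Y) X = f * g Y X"
  "X \<in> VF \<Longrightarrow> g 0 X = 0"
  using one_form_simps[OF g_form[of X]] one_form_simps[OF g_form'[of X]] by auto

lemma g_pos: "X \<in> VF \<Longrightarrow> X p \<noteq> 0 \<Longrightarrow> g X X p > 0"
  using metric by (simp add: riemannian_metric_def)

lemma g_eq_0: "X \<in> VF \<Longrightarrow> g X X = 0 \<Longrightarrow> X = 0"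
  using g_pos[of X] by (metis ext less_irrefl zero_fun_apply)

lemma g_nondegenerate: "U \<in> VF \<Longrightarrow> (\<And>Z. Z \<in> VF \<Longrightarrow> g U Z = 0) \<Longrightarrow> U = 0"
  by (rule g_eq_0) auto

lemma D_VF [simp]: "X \<in> VF \<Longrightarrow> Y \<in> VF \<Longrightarrow> D X Y \<in> VF"
  using connection by (simp add: affine_connection_def)

lemma D_form: "Y \<in> VF \<Longrightarrow> endo_field A (\<lambda>X. D X Y)"
  using connection by (simp add: affine_connection_def endo_field_def)

lemma D_add [simp]: "X \<in> VF \<Longrightarrow> Y \<in> VF \<Longrightarrow> Z \<in> VF \<Longrightarrow> D X (Y + Z) = D X Y + D X Z"
  using connection by (simp add: affine_connection_def)

lemma D_scale [simp]:
  "X \<in> VF \<Longrightarrow> Y \<in> VF \<Longrightarrow> f \<in> SF \<Longrightarrow> D X (f \<odot> Y) = (X \<bullet>\<^sub>v f) \<odot> Y + f \<odot> D X Y"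
  using connection by (simp add: affine_connection_def)

lemma D_const: "X \<in> VF \<Longrightarrow> Y \<in> VF \<Longrightarrow> D X (a \<odot>\<^sub>R Y) = a \<odot>\<^sub>R D X Y"
  by (simp add: vapply_const)

lemma D_simps [simp]:
  "X \<in> VF \<Longrightarrow> Y \<in> VF \<Longrightarrow> D X (- Y) = - D X Y"
  "X \<in> VF \<Longrightarrow> Y \<in> VF \<Longrightarrow> Z \<in> VF \<Longrightarrow> D X (Y - Z) = D X Y - D X Z"
  "X \<in> VF \<Longrightarrow> D X 0 = 0"
  "X \<in> VF \<Longrightarrow> X' \<in> VF \<Longrightarrow> Y \<in> VF \<Longrightarrow> D (X + X') Y = D X Y + D X' Y"
  "X \<in> VF \<Longrightarrow> X' \<in> VF \<Longrightarrow> Y \<in> VF \<Longrightarrow> D (X - X') Y = D X Y - D X' Y"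
  "X \<in> VF \<Longrightarrow> Y \<in> VF \<Longrightarrow> D (- X) Y = - D X Y"
  "X \<in> VF \<Longrightarrow> Y \<in> VF \<Longrightarrow> f \<in> SF \<Longrightarrow> D (f \<odot> X) Y = f \<odot> D X Y"
proof -
  show m: "D X (- Y) = - D X Y" if "X \<in> VF" "Y \<in> VF" for X Y
    using D_const[OF that, of "- 1"] by (simp add: fscale_minus1)
  show "D X (Y - Z) = D X Y - D X Z" if "X \<in> VF" "Y \<in> VF" "Z \<in> VF"
    using D_add[of X Y "- Z"] m[of X Z] that by simp
  show "D X 0 = 0" if "X \<in> VF"
    using D_add[of X 0 0] that by simp
qed (use endo_field_simps[OF D_form[of Y]] in auto)

lemma metric_derivative:
  "X \<in> VF \<Longrightarrow> Y \<in> VF \<Longrightarrow> Z \<in> VF \<Longrightarrow> X \<bullet>\<^sub>v g Y Z = g (D X Y) Z + g Y (D X Z)"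
  using parallel_metric by (simp add: parallel_form2_def cov_form2_def algebra_simps)

lemma cov_endo_field:
  assumes \<psi>: "endo_field A \<psi>"
  shows "Y \<in> VF \<Longrightarrow> endo_field A (\<lambda>X. cov_endo D X \<psi> Y)"
    and "X \<in> VF \<Longrightarrow> endo_field A (cov_endo D X \<psi>)"
  using endo_field_simps[OF \<psi>]
  by (auto simp: endo_field_def cov_endo_def) (intro ext, simp add: fscale_def algebra_simps)+

text \<open>Differentiate g(\<psi> Y, Z) = - g(Y, \<psi> Z) along X; the terms differentiating only
  Y or Z cancel by skewness.\<close>

lemma cov_endo_skew:
  assumes \<psi>: "endo_field A \<psi>" and skew: "\<And>X Y. X \<in> VF \<Longrightarrow> Y \<in> VF \<Longrightarrow> g (\<psi> X) Y = - g X (\<psi> Y)"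
    and XYZ: "X \<in> VF" "Y \<in> VF" "Z \<in> VF"
  shows "g (cov_endo D X \<psi> Y) Z = - g Y (cov_endo D X \<psi> Z)"
proof -
  note [simp] = endo_field_simps[OF \<psi>] XYZ
  have "X \<bullet>\<^sub>v g (\<psi> Y) Z = X \<bullet>\<^sub>v (- g Y (\<psi> Z))"
    by (simp add: skew)
  then have "g (D X (\<psi> Y)) Z + g (\<psi> Y) (D X Z) = - (g (D X Y) (\<psi> Z) + g Y (D X (\<psi> Z)))"
    by (simp only: metric_derivative vapply_uminus XYZ g_SF endo_fieldD(1)[OF \<psi>])
  then show ?thesis
    using skew[of Y "D X Z"] skew[of "D X Y" Z] by (simp add: cov_endo_def algebra_simps)
qed

lemma cov_fundamental_form:
  assumes "endo_field A \<psi>" "X \<in> VF" "Y \<in> VF" "Z \<in> VF"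
  shows "cov_form2 D X (fundamental_form g \<psi>) Y Z = g (cov_endo D X \<psi> Y) Z"
  using assms endo_fieldD(1)[OF assms(1)]
  by (simp add: cov_form2_def fundamental_form_def metric_derivative cov_endo_def)

text \<open>\<open>d\<omega>\<close> is the cyclic sum of \<open>\<nabla>\<omega>\<close> and \<open>\<omega>(T(\<cdot>,\<cdot>),\<cdot>)\<close>.\<close>

lemma ext_deriv2_fundamental_form:
  assumes \<psi>: "endo_field A \<psi>" and skew: "\<And>X Y. X \<in> VF \<Longrightarrow> Y \<in> VF \<Longrightarrow> g (\<psi> X) Y = - g X (\<psi> Y)"
    and bracket: "\<And>X Y. X \<in> VF \<Longrightarrow> Y \<in> VF \<Longrightarrow> lie_bracket X Y \<in> VF"
    and XYZ: "X \<in> VF" "Y \<in> VF" "Z \<in> VF"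
  shows "ext_deriv2 (fundamental_form g \<psi>) X Y Z =
    g (cov_endo D X \<psi> Y) Z + g (cov_endo D Y \<psi> Z) X + g (cov_endo D Z \<psi> X) Y
    + g (\<psi> (torsion D X Y)) Z + g (\<psi> (torsion D Y Z)) X + g (\<psi> (torsion D Z X)) Y"
proof -
  note [simp] = endo_field_simps[OF \<psi>] XYZ bracket
  have sw: "g (\<psi> U) V = - g (\<psi> V) U" if "U \<in> VF" "V \<in> VF" for U V
    using skew[OF that] g_sym[of U "\<psi> V"] that by simp
  show ?thesis
    using sw[of X "D Y Z"] sw[of X "D Z Y"] sw[of Y "D X Z"] sw[of Y "D Z X"] sw[of Z "D X Y"] sw[of Z "D Y X"]
    by (simp add: ext_deriv2_def fundamental_form_def metric_derivative cov_endo_def torsion_def algebra_simps)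
qed

end

section \<open>Jacobi identity and the vanishing of d after d\<close>

lemma (in manifold) lie_bracket_jacobi:
  assumes "X \<in> VF" "Y \<in> VF" "Z \<in> VF"
  shows "lie_bracket (lie_bracket X Y) Z + lie_bracket (lie_bracket Y Z) X + lie_bracket (lie_bracket Z X) Y = 0"
proof (intro ext)
  fix p f
  have e: "lie_bracket U V \<bullet>\<^sub>v f = U \<bullet>\<^sub>v V \<bullet>\<^sub>v f - V \<bullet>\<^sub>v U \<bullet>\<^sub>v f" for U V f
    by (auto simp: lie_bracket_def vapply_def)
  have v: "U p k = (U \<bullet>\<^sub>v k) p" for U :: "'m vfield" and k by (simp add: vapply_def)
  \<comment> \<open>Derivations are 0 on non-smooth functions by convention, so that case is
    separate from the usual cancellation.\<close>
  have z: "U \<bullet>\<^sub>v f = 0" if "U \<in> VF" "f \<notin> SF" for U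
    using tangentD(1)[OF VF_D[OF that(1)] that(2)] by (auto simp: vapply_def)
  show "(lie_bracket (lie_bracket X Y) Z + lie_bracket (lie_bracket Y Z) X + lie_bracket (lie_bracket Z X) Y) p f
      = (0 :: 'm vfield) p f"
    using assms by (cases "f \<in> SF") (simp_all add: v e z vapply_diff)
qed

text \<open>Second derivatives cancel against brackets, and the rest is the Jacobi identity under
  \<alpha>. Closure under the bracket is a hypothesis; the torsion-free connection supplies it later
  through [X,Y] = D X Y - D Y X.\<close>

lemma (in manifold) ext_deriv2_ext_deriv1:
  assumes \<alpha>: "one_form A \<alpha>" and bracket: "\<And>X Y. X \<in> VF \<Longrightarrow> Y \<in> VF \<Longrightarrow> lie_bracket X Y \<in> VF"
    and XYZ: "X \<in> VF" "Y \<in> VF" "Z \<in> VF"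
  shows "ext_deriv2 (ext_deriv1 \<alpha>) X Y Z = 0"
proof -
  note [simp] = one_form_simps[OF \<alpha>] bracket XYZ
  have e: "lie_bracket U V \<bullet>\<^sub>v f = U \<bullet>\<^sub>v V \<bullet>\<^sub>v f - V \<bullet>\<^sub>v U \<bullet>\<^sub>v f" for U V f
    by (auto simp: lie_bracket_def vapply_def)
  have "\<alpha> (lie_bracket (lie_bracket X Y) Z) + \<alpha> (lie_bracket (lie_bracket Y Z) X)
      + \<alpha> (lie_bracket (lie_bracket Z X) Y) = 0"
    using arg_cong[OF lie_bracket_jacobi[OF XYZ], of \<alpha>] by simp
  then show ?thesis
    by (simp add: ext_deriv2_def ext_deriv1_def vapply_diff vapply_add e algebra_simps)
qed

section \<open>Nearly Sasakian structures in dimension five\<close>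

lemma forall_5: "(\<forall>i::5. P i) \<longleftrightarrow> P 1 \<and> P 2 \<and> P 3 \<and> P 4 \<and> P 5"
proof -
  have "i = 1 \<or> i = 2 \<or> i = 3 \<or> i = 4 \<or> i = 5" for i :: 5
  proof (induct i)
    case (of_int z)
    then have "z = 0 \<or> z = 1 \<or> z = 2 \<or> z = 3 \<or> z = 4" by fastforce
    then show ?case by auto
  qed
  then show ?thesis by metis
qed

locale nearly_sasakian5 = manifold A
  for A :: "('m::{t2_space,second_countable_topology}, real^5) atlas" +
  fixes D :: "'m connection" and \<phi> h :: "'m endo" and \<xi> :: "'m vfield"
    and \<eta> :: "'m form1" and g :: "'m form2" and lam :: real
  assumes nearly_sasakian: "nearly_sasakian A D \<phi> \<xi> \<eta> g"
    and D_xi: "X \<in> VF \<Longrightarrow> D X \<xi> = - \<phi> X + h X"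
    and lam: "lam \<noteq> 0"
    and h_h: "X \<in> VF \<Longrightarrow> h (h X) = (- (lam\<^sup>2)) \<odot>\<^sub>R (X - \<eta> X \<odot> \<xi>)"
begin

sublocale metric_connection A g D
  using nearly_sasakian
  by unfold_locales (auto simp: nearly_sasakian_def levi_civita_def)

lemma acm: "almost_contact_metric A \<phi> \<xi> \<eta> g"
  using nearly_sasakian by (simp add: nearly_sasakian_def)

lemma phi_field: "endo_field A \<phi>" and eta_form: "one_form A \<eta>" and xi_VF [simp]: "\<xi> \<in> VF"
  and phi_phi [simp]: "X \<in> VF \<Longrightarrow> \<phi> (\<phi> X) = - X + \<eta> X \<odot> \<xi>" and eta_xi [simp]: "\<eta> \<xi> = 1"
  and g_phi_phi: "X \<in> VF \<Longrightarrow> Y \<in> VF \<Longrightarrow> g (\<phi> X) (\<phi> Y) = g X Y - \<eta> X * \<eta> Y"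
  using acm by (simp_all add: almost_contact_metric_def)

lemmas [simp] = endo_field_simps[OF phi_field] one_form_simps[OF eta_form]

lemma phi_xi [simp]: "\<phi> \<xi> = 0" and eta_phi [simp]: "X \<in> VF \<Longrightarrow> \<eta> (\<phi> X) = 0"
proof -
  \<comment> \<open>Compare the two ways of contracting \<phi>(\<phi>(\<phi> X)).\<close>
  have eq: "\<eta> X \<odot> \<phi> \<xi> = \<eta> (\<phi> X) \<odot> \<xi>" if X: "X \<in> VF" for X
  proof -
    have "\<phi> (- X + \<eta> X \<odot> \<xi>) = - \<phi> X + \<eta> (\<phi> X) \<odot> \<xi>"
      unfolding phi_phi[OF X, symmetric] using X by (intro phi_phi) simp
    then show ?thesis using X by simp
  qed
  have one: "1 \<odot> X = X" for X :: "'m vfield" by (intro ext) (simp add: fscale_def)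
  have xi: "\<phi> \<xi> = \<eta> (\<phi> \<xi>) \<odot> \<xi>"
    using eq[of \<xi>] by (simp add: one)
  have "\<phi> (\<phi> \<xi>) = 0"
    by (simp add: one)
  then have "\<eta> (\<phi> \<xi>) \<odot> \<phi> \<xi> = 0"
    using xi by (metis endo_fieldD(1,3)[OF phi_field] one_formD(1)[OF eta_form] xi_VF)
  then have "\<eta> (\<eta> (\<phi> \<xi>) \<odot> \<phi> \<xi>) = 0"
    by simp
  then have "\<eta> (\<phi> \<xi>) = 0"
    by (simp add: fun_eq_iff)
  then show z: "\<phi> \<xi> = 0" using xi by simp
  fix X
  assume X: "X \<in> VF"
  have "\<eta> (\<eta> (\<phi> X) \<odot> \<xi>) = 0"
    using eq[OF X] X z by simp
  then show "\<eta> (\<phi> X) = 0" using X by simp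
qed

lemma g_xi [simp]: "X \<in> VF \<Longrightarrow> g X \<xi> = \<eta> X" "X \<in> VF \<Longrightarrow> g \<xi> X = \<eta> X"
  using g_phi_phi[of X \<xi>] g_sym[of X \<xi>] by auto

lemma phi_skew [simp]:
  assumes "X \<in> VF" "Y \<in> VF" shows "g X (\<phi> Y) = - g (\<phi> X) Y"
  using g_phi_phi[of X "\<phi> Y"] assms by simp

lemma h_eq: "X \<in> VF \<Longrightarrow> h X = D X \<xi> + \<phi> X"
  by (simp add: D_xi)

text \<open>\<open>h\<close> is given only by its values in \<open>D_xi\<close>; it inherits
  tensoriality from \<phi> and from \<nabla>\<xi>, which is function-linear in the
  direction.\<close>

lemma h_field: "endo_field A h"
  unfolding endo_field_def
  by (auto simp: h_eq) (intro ext, simp add: fscale_def algebra_simps)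

lemmas [simp] = endo_field_simps[OF h_field]

lemma eta_h [simp]:
  assumes "X \<in> VF" shows "\<eta> (h X) = 0"
proof -
  have "X \<bullet>\<^sub>v g \<xi> \<xi> = g (D X \<xi>) \<xi> + g \<xi> (D X \<xi>)"
    using assms by (intro metric_derivative) auto
  then have "0 = 2 * \<eta> (h X)"
    using assms by (simp add: vapply_one D_xi)
  then show ?thesis by (simp add: fun_eq_iff)
qed

section \<open>The derivative of \<phi> and the algebra of h\<close>

abbreviation "F X \<equiv> cov_endo D X \<phi>"

lemma F_sym:
  assumes "X \<in> VF" "Y \<in> VF"
  shows "F X Y = (2 * g X Y) \<odot> \<xi> - \<eta> X \<odot> Y - \<eta> Y \<odot> X - F Y X"
  using nearly_sasakian assms by (simp add: nearly_sasakian_def eq_diff_eq)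

lemma D_eta:
  assumes "X \<in> VF" "Y \<in> VF"
  shows "X \<bullet>\<^sub>v \<eta> Y = \<eta> (D X Y) + g (D X \<xi>) Y"
  using metric_derivative[of X Y \<xi>] g_sym[of Y "D X \<xi>"] assms by simp

text \<open>The covariant derivative of \<phi>^2 = -I + \<eta> \<otimes> \<xi>.\<close>

lemma F_phi:
  assumes "X \<in> VF" "Y \<in> VF"
  shows "F X (\<phi> Y) = - \<phi> (F X Y) + g (D X \<xi>) Y \<odot> \<xi> + \<eta> Y \<odot> D X \<xi>"
  using assms
  by (simp add: cov_endo_def D_eta D_xi) (intro ext, simp add: fscale_def algebra_simps)

lemma F_xi: "X \<in> VF \<Longrightarrow> F X \<xi> = - X + \<eta> X \<odot> \<xi> - \<phi> (h X)"
  by (simp add: cov_endo_def D_xi)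

lemma F_VF [simp]: "X \<in> VF \<Longrightarrow> Y \<in> VF \<Longrightarrow> F X Y \<in> VF"
  by (simp add: cov_endo_def)

text \<open>The nearly Sasakian identity with one argument \<xi>. All algebra of \<open>h\<close>
  comes from here: comparison with \<open>F_xi\<close> at \<xi> gives h \<xi> = 0, comparison with
  \<open>F_phi\<close> gives h \<phi> = - \<phi> h, and skewness of \<nabla>_\<xi> \<phi> gives that
  of h.\<close>

lemma xi_F: "X \<in> VF \<Longrightarrow> F \<xi> X = \<phi> (h X)"
  by (subst F_sym) (simp_all add: F_xi, intro ext, simp add: fscale_def)

lemma h_xi [simp]: "h \<xi> = 0"
proof -
  have "\<phi> (h \<xi>) = 0"
    using xi_F[of \<xi>] F_xi[of \<xi>] by (simp add: fscale_def fun_eq_iff)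
  then have "\<phi> (\<phi> (h \<xi>)) = 0" by simp
  then show ?thesis by simp
qed

lemma h_phi [simp]: "X \<in> VF \<Longrightarrow> h (\<phi> X) = - \<phi> (h X)"
proof -
  assume X: "X \<in> VF"
  have "\<phi> (h (\<phi> X)) = h X"
    using F_phi[of \<xi> X] X by (simp add: xi_F D_xi)
  then have "\<phi> (\<phi> (h (\<phi> X))) = \<phi> (h X)" by simp
  then show ?thesis using X by (simp add: equation_minus_iff)
qed

lemma F_skew: "X \<in> VF \<Longrightarrow> Y \<in> VF \<Longrightarrow> Z \<in> VF \<Longrightarrow> g (F X Y) Z = - g Y (F X Z)"
  by (rule cov_endo_skew[OF phi_field]) auto

lemma h_skew [simp]:
  assumes "X \<in> VF" "Y \<in> VF" shows "g X (h Y) = - g (h X) Y"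
  using F_skew[of \<xi> X "\<phi> Y"] assms by (simp add: xi_F)

lemma phi_swap: "X \<in> VF \<Longrightarrow> Y \<in> VF \<Longrightarrow> g (\<phi> X) Y = - g (\<phi> Y) X"
  using phi_skew[of Y X] g_sym[of "\<phi> X" Y] by simp

lemma h_swap: "X \<in> VF \<Longrightarrow> Y \<in> VF \<Longrightarrow> g (h X) Y = - g (h Y) X"
  using h_skew[of Y X] g_sym[of "h X" Y] by simp

lemmas [simp] = h_h

text \<open>At a point where \<open>Z\<close> is horizontal and nonzero, \<open>\<xi>, Z, \<phi> Z, h Z, \<phi> h Z\<close> are orthogonal, hence a
  basis of the five-dimensional tangent space.\<close>

lemma tangent_basis:
  assumes Z: "Z \<in> VF" "\<eta> Z = 0" "Z p \<noteq> 0" and X: "X \<in> VF"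
  obtains c0 c1 c2 c3 c4 where "\<And>\<alpha>. one_form A \<alpha> \<Longrightarrow>
    \<alpha> X p = c0 * \<alpha> \<xi> p + c1 * \<alpha> Z p + c2 * \<alpha> (\<phi> Z) p + c3 * \<alpha> (h Z) p + c4 * \<alpha> (\<phi> (h Z)) p"
proof (rule tangent_coordinates[of p])
  fix w :: "'m vfield \<Rightarrow> real^5"
  assume w: "\<And>X Y. X \<in> VF \<Longrightarrow> Y \<in> VF \<Longrightarrow> w (X + Y) = w X + w Y"
    "\<And>f X. f \<in> SF \<Longrightarrow> X \<in> VF \<Longrightarrow> w (f \<odot> X) = f p *\<^sub>R w X"
    "\<And>X. X \<in> VF \<Longrightarrow> w X = 0 \<Longrightarrow> \<forall>\<alpha>. one_form A \<alpha> \<longrightarrow> \<alpha> X p = 0"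
  let ?V = "\<lambda>c0 c1 c2 c3 c4. c0 \<odot>\<^sub>R \<xi> + c1 \<odot>\<^sub>R Z + c2 \<odot>\<^sub>R \<phi> Z + c3 \<odot>\<^sub>R h Z + c4 \<odot>\<^sub>R \<phi> (h Z)"
  define f where "f c = w (?V (c$1) (c$2) (c$3) (c$4) (c$5))" for c :: "real^5"
  have V: "?V c0 c1 c2 c3 c4 \<in> VF" for c0 c1 c2 c3 c4
    using Z by simp
  have alpha_V: "\<alpha> (?V c0 c1 c2 c3 c4) p
      = c0 * \<alpha> \<xi> p + c1 * \<alpha> Z p + c2 * \<alpha> (\<phi> Z) p + c3 * \<alpha> (h Z) p + c4 * \<alpha> (\<phi> (h Z)) p"
    if "one_form A \<alpha>" for \<alpha> c0 c1 c2 c3 c4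
    using one_form_simps[OF that] Z by simp
  have f: "f c = c$1 *\<^sub>R w \<xi> + c$2 *\<^sub>R w Z + c$3 *\<^sub>R w (\<phi> Z) + c$4 *\<^sub>R w (h Z) + c$5 *\<^sub>R w (\<phi> (h Z))" for c
    unfolding f_def using Z by (simp add: w(1,2))
  have lin: "linear f"
    by (rule linearI) (simp_all add: f algebra_simps)
  have "c = 0" if c: "f c = 0" for c
  proof -
    have zero: "\<alpha> (?V (c$1) (c$2) (c$3) (c$4) (c$5)) p = 0" if "one_form A \<alpha>" for \<alpha>
      using w(3)[OF V] c that unfolding f_def by blast
    have N: "g Z Z p > 0" using g_pos Z by blast
    have s: "g (\<phi> Z) Z = 0" "g (h Z) Z = 0"
      using phi_skew[of Z Z] h_skew[of Z Z] g_sym[of Z "\<phi> Z"] g_sym[of Z "h Z"] Z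
      by (auto simp: fun_eq_iff)
    have s': "g (\<phi> (h Z)) Z = 0"
      using phi_skew[of "h Z" Z] h_skew[of "\<phi> Z" Z] g_sym[of Z "\<phi> (h Z)"] Z
      by (auto simp: fun_eq_iff)
    \<comment> \<open>Pairing with each of the five fields isolates one coefficient, multiplied by
      1, g(Z,Z) or \<open>lam\<close>^2 g(Z,Z) at p.\<close>
    note e = zero[OF g_form', unfolded alpha_V[OF g_form']]
    have "c$1 = 0" using e[of \<xi>] Z by simp
    moreover have "c$2 = 0" using e[of Z] Z N s s' by simp
    moreover have "c$3 = 0" using e[of "\<phi> Z"] Z N s s' by simp
    moreover have "c$4 = 0" using e[of "h Z"] Z N s s' lam by simp
    moreover have "c$5 = 0" using e[of "\<phi> (h Z)"] Z N s s' lam by simp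
    ultimately show ?thesis by (simp add: vec_eq_iff forall_5)
  qed
  \<comment> \<open>Dimension five enters here: an injective linear endomorphism of
    \<open>real^5\<close> is surjective.\<close>
  then have "surj f"
    using lin linear_injective_0 linear_injective_imp_surjective by blast
  then obtain c where c: "f c = w X" by (metis surjD)
  let ?V' = "?V (c$1) (c$2) (c$3) (c$4) (c$5)"
  have "w (X - ?V') = w (X + (\<lambda>_. - 1) \<odot> ?V')"
    by (simp only: fscale_minus1 add_uminus_conv_diff)
  also have "\<dots> = w X - w ?V'"
    using w(1,2) X V by simp
  finally have "w (X - ?V') = 0"
    using c by (simp add: f_def)
  then have zero: "\<alpha> (X - ?V') p = 0" if "one_form A \<alpha>" for \<alpha>
    using w(3) VF_diff[OF X V] that by blast
  have "\<alpha> X p = \<alpha> ?V' p" if "one_form A \<alpha>" for \<alpha>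
    using zero[OF that] unfolding one_form_diff[OF that X V] minus_apply by linarith
  then show ?thesis
    by (intro that[of "c$1" "c$2" "c$3" "c$4" "c$5"]) (simp add: alpha_V)
qed

section \<open>Two vanishing theorems for trilinear forms\<close>

definition trilinear :: "('m vfield \<Rightarrow> 'm form2) \<Rightarrow> bool" where
  "trilinear t \<longleftrightarrow> (\<forall>X\<in>VF. \<forall>Y\<in>VF.
    one_form A (\<lambda>Z. t X Y Z) \<and> one_form A (\<lambda>Z. t X Z Y) \<and> one_form A (\<lambda>Z. t Z X Y))"

text \<open>Subtracting \<eta>(Z)\<xi> does not change the value, and where the difference vanishes
  at p the form does too. What remains is exactly the situation of
  \<open>tangent_basis\<close>.\<close>

lemma trilinear_horizontal:
  assumes t: "trilinear t" and xi: "\<And>X Y. X \<in> VF \<Longrightarrow> Y \<in> VF \<Longrightarrow> t X Y \<xi> = 0"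
    and XYZ: "X \<in> VF" "Y \<in> VF" "Z \<in> VF"
    and hor: "\<And>Z p. Z \<in> VF \<Longrightarrow> \<eta> Z = 0 \<Longrightarrow> Z p \<noteq> 0 \<Longrightarrow> t X Y Z p = 0"
  shows "t X Y Z = 0"
proof
  fix p
  let ?Z = "Z - \<eta> Z \<odot> \<xi>"
  have form: "one_form A (t X Y)"
    using t XYZ by (simp add: trilinear_def)
  have Z: "?Z \<in> VF" "\<eta> ?Z = 0"
    using XYZ by simp_all
  have "t X Y ?Z p = 0"
    using hor[OF Z, of p] one_form_pointwise[OF form Z(1), of p] by blast
  moreover have "t X Y ?Z = t X Y Z"
    using one_form_simps[OF form] XYZ xi by simp
  ultimately show "t X Y Z p = 0 p" by simp
qed

text \<open>The real part of a form of type \<open>(3,0)\<close> vanishes on the horizontal distribution, which has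
  complex dimension two.\<close>

lemma three_form_zero:
  assumes t: "trilinear t"
    and skew12: "\<And>X Y Z. X \<in> VF \<Longrightarrow> Y \<in> VF \<Longrightarrow> Z \<in> VF \<Longrightarrow> t X Y Z = - t Y X Z"
    and skew23: "\<And>X Y Z. X \<in> VF \<Longrightarrow> Y \<in> VF \<Longrightarrow> Z \<in> VF \<Longrightarrow> t X Y Z = - t X Z Y"
    and xi: "\<And>X Y. X \<in> VF \<Longrightarrow> Y \<in> VF \<Longrightarrow> t X Y \<xi> = 0"
    and phi: "\<And>X Y Z. X \<in> VF \<Longrightarrow> Y \<in> VF \<Longrightarrow> Z \<in> VF \<Longrightarrow> t X (\<phi> Y) Z = t X Y (\<phi> Z)"
    and XYZ: "X \<in> VF" "Y \<in> VF" "Z \<in> VF"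
  shows "t X Y Z = 0"
proof (rule trilinear_horizontal[OF t xi XYZ])
  fix Z p
  assume Z: "Z \<in> VF" "\<eta> Z = 0" "Z p \<noteq> 0"
  have zero: "a = 0" if "a = - a" for a :: "'m \<Rightarrow> real"
    using that by (simp add: fun_eq_iff)
  have d23: "t U V V = 0" if "U \<in> VF" "V \<in> VF" for U V
    by (rule zero) (rule skew23[OF that that(2)])
  have d12: "t V V U = 0" if "U \<in> VF" "V \<in> VF" for U V
    by (rule zero) (rule skew12[OF that(2,2,1)])
  have d13: "t V U V = 0" if "U \<in> VF" "V \<in> VF" for U V
    using skew12[of V U V] d23[of U V] that by simp
  \<comment> \<open>Moving \<phi> to the other slot and exchanging the slots give opposite
    signs.\<close>
  have phi2: "t U (\<phi> V) V = 0" if "U \<in> VF" "V \<in> VF" for U V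
    using zero[of "t U (\<phi> V) V"] phi[of U V V] skew23[of U "\<phi> V" V] that by auto
  \<comment> \<open>Each basis value of V gives 0; for \<phi> h Z, moving \<phi> to the last slot
    leaves h Z twice.\<close>
  have hZ: "t (h Z) V Z p = 0" if V: "V \<in> VF" for V
  proof (rule tangent_basis[OF Z V])
    fix c0 c1 c2 c3 c4
    assume c: "\<And>\<alpha>. one_form A \<alpha> \<Longrightarrow> \<alpha> V p
      = c0 * \<alpha> \<xi> p + c1 * \<alpha> Z p + c2 * \<alpha> (\<phi> Z) p + c3 * \<alpha> (h Z) p + c4 * \<alpha> (\<phi> (h Z)) p"
    have "one_form A (\<lambda>V. t (h Z) V Z)"
      using t Z by (simp add: trilinear_def)
    from c[OF this] show ?thesis
      using skew23[of "h Z" \<xi> Z] xi[of "h Z" Z] d23[of "h Z" Z] phi2[of "h Z" Z] d12[of Z "h Z"]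
        phi[of "h Z" "h Z" Z] d12[of "\<phi> Z" "h Z"] Z by simp
  qed
  show "t X Y Z p = 0"
  proof (rule tangent_basis[OF Z XYZ(1)])
    fix c0 c1 c2 c3 c4
    assume c: "\<And>\<alpha>. one_form A \<alpha> \<Longrightarrow> \<alpha> X p
      = c0 * \<alpha> \<xi> p + c1 * \<alpha> Z p + c2 * \<alpha> (\<phi> Z) p + c3 * \<alpha> (h Z) p + c4 * \<alpha> (\<phi> (h Z)) p"
    have form: "one_form A (\<lambda>X. t X Y Z)"
      using t Z XYZ by (simp add: trilinear_def)
    have "t \<xi> Y Z = 0"
      using skew12[of \<xi> Y Z] skew23[of Y \<xi> Z] xi[of Y Z] Z XYZ by simp
    moreover have "t (\<phi> Z) Y Z = 0"
      using skew12[of "\<phi> Z" Y Z] phi2[of Y Z] Z XYZ by simp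
    \<comment> \<open>Shift \<phi> from the first argument to Y through the slots; the result is an
      instance of \<open>hZ\<close>.\<close>
    moreover have "t (\<phi> (h Z)) Y Z p = 0"
    proof -
      have "t (\<phi> (h Z)) Y Z = - t Y (\<phi> (h Z)) Z"
        using skew12[of "\<phi> (h Z)" Y Z] Z XYZ by simp
      also have "\<dots> = - t Y (h Z) (\<phi> Z)"
        using phi[of Y "h Z" Z] Z XYZ by simp
      also have "\<dots> = t (h Z) Y (\<phi> Z)"
        using skew12[of Y "h Z" "\<phi> Z"] Z XYZ by simp
      also have "\<dots> = t (h Z) (\<phi> Y) Z"
        using phi[of "h Z" Y Z] Z XYZ by simp
      finally show ?thesis using hZ[of "\<phi> Y"] XYZ by simp
    qed
    ultimately show ?thesis
      using c[OF form] d13[of Y Z] hZ[OF XYZ(2)] Z XYZ by simp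
  qed
qed

text \<open>Skew endomorphisms of the horizontal distribution anticommuting with \<open>\<phi>\<close> and \<open>h\<close> are multiples
  of \<open>\<phi> h\<close>, so \<open>t = \<beta> \<otimes> g(\<phi> h \<cdot>, \<cdot>)\<close>; the cyclic identity then forces \<open>\<beta> = 0\<close>.\<close>

lemma cyclic_form_zero:
  assumes t: "trilinear t"
    and skew: "\<And>X Y Z. X \<in> VF \<Longrightarrow> Y \<in> VF \<Longrightarrow> Z \<in> VF \<Longrightarrow> t X Y Z = - t X Z Y"
    and cyclic: "\<And>X Y Z. X \<in> VF \<Longrightarrow> Y \<in> VF \<Longrightarrow> Z \<in> VF \<Longrightarrow> t X Y Z + t Y Z X + t Z X Y = 0"
    and xi: "\<And>X Y. X \<in> VF \<Longrightarrow> Y \<in> VF \<Longrightarrow> t X Y \<xi> = 0"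
    and phi: "\<And>X Y Z. X \<in> VF \<Longrightarrow> Y \<in> VF \<Longrightarrow> Z \<in> VF \<Longrightarrow> t X (\<phi> Y) Z = t X Y (\<phi> Z)"
    and h: "\<And>X Y Z. X \<in> VF \<Longrightarrow> Y \<in> VF \<Longrightarrow> Z \<in> VF \<Longrightarrow> t X (h Y) Z = t X Y (h Z)"
    and XYZ: "X \<in> VF" "Y \<in> VF" "Z \<in> VF"
  shows "t X Y Z = 0"
proof (rule trilinear_horizontal[OF t xi XYZ])
  fix Z p
  assume Z: "Z \<in> VF" "\<eta> Z = 0" "Z p \<noteq> 0"
  have zero: "a = 0" if "a = - a" for a :: "'m \<Rightarrow> real"
    using that by (simp add: fun_eq_iff)
  have d: "t U V V = 0" if "U \<in> VF" "V \<in> VF" for U V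
    by (rule zero) (rule skew[OF that that(2)])
  have dphi: "t U (\<phi> V) V = 0" "t U V (\<phi> V) = 0" if "U \<in> VF" "V \<in> VF" for U V
    using zero[of "t U (\<phi> V) V"] phi[of U V V] skew[of U "\<phi> V" V] that by auto
  have dh: "t U (h V) V = 0" "t U V (h V) = 0" if "U \<in> VF" "V \<in> VF" for U V
    using zero[of "t U (h V) V"] h[of U V V] skew[of U "h V" V] that by auto
  have form2: "one_form A (\<lambda>V. t U V W)" "one_form A (t U V)"
    and form1: "one_form A (\<lambda>U. t U V W)" if "U \<in> VF" "V \<in> VF" "W \<in> VF" for U V W
    using t that by (auto simp: trilinear_def)
  \<comment> \<open>If t = \<beta> \<otimes> g(\<phi> h . , .), then for horizontal e this is -
    \<open>lam\<close>^2 g(e,e) \<beta>(U), so it measures \<beta> without dividing.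
    \<open>q_phi\<close> and \<open>q_h\<close> reflect that \<phi> preserves the length of e and h
    multiplies it by the absolute value of \<open>lam\<close>.\<close>
  let ?q = "\<lambda>U e. t U (\<phi> (h e)) e"
  have q_phi: "?q U (\<phi> e) = ?q U e" if "U \<in> VF" "e \<in> VF" for U e
    using phi[of U "\<phi> (h (\<phi> e))" e] phi[of U "h e" e] skew[of U \<xi> e] xi[of U e] that
      one_form_simps[OF form2(1)[OF that(1) that(2) that(2)]] by simp
  have q_h: "?q U (h e) = (\<lambda>_. lam\<^sup>2) * ?q U e" if "U \<in> VF" "\<eta> e = 0" "e \<in> VF" for U e
  proof -
    have "t U (\<phi> e) (h e) = - ?q U e"
      using h[of U "\<phi> e" e] that one_form_uminus[OF form2(1)[OF that(1) that(3) that(3)]] by simp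
    then show ?thesis
      using that one_form_simps[OF form2(1)[OF that(1) that(3) endo_fieldD(1)[OF h_field that(3)]]]
      by (simp add: fun_eq_iff)
  qed
  \<comment> \<open>Of the three cyclic terms in \<phi> e, \<phi> h e, e only this one survives.
    Together with \<open>q2\<close>, and with \<open>q1\<close> applied to h Z and \<phi> Z, it
    shows that \<beta> vanishes on every basis vector.\<close>
  have q1: "?q (\<phi> e) e = 0" if e: "e \<in> VF" for e
    using cyclic[of "\<phi> e" "\<phi> (h e)" e] dphi[of "\<phi> (h e)" e] phi[of e e "\<phi> (h e)"] dh(2)[of e e] e
      one_form_simps[OF form2(2)[OF e e e]] by simp
  have q2: "?q (h e) e = 0" if e: "e \<in> VF" for e
    using cyclic[of "h e" "\<phi> (h e)" e] dh[of "\<phi> (h e)" e] dphi(2)[of e "h e"] e by simp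
  have q3: "?q (\<phi> (h Z)) Z = 0"
    using q1[of "h Z"] q_h[of "\<phi> (h Z)" Z] Z lam by (simp add: fun_eq_iff)
  have q0: "?q Z Z = 0"
    using q1[of "\<phi> Z"] q_phi[of Z Z] Z one_form_uminus[OF form1[where U = Z and V = "h Z" and W = "\<phi> Z"], of Z] by simp
  have qxi: "?q \<xi> Z = 0"
    using cyclic[of \<xi> "\<phi> (h Z)" Z] xi skew[of Z \<xi> "\<phi> (h Z)"] Z by simp
  have qX: "?q X Z p = 0"
  proof (rule tangent_basis[OF Z XYZ(1)])
    fix c0 c1 c2 c3 c4
    assume c: "\<And>\<alpha>. one_form A \<alpha> \<Longrightarrow> \<alpha> X p
      = c0 * \<alpha> \<xi> p + c1 * \<alpha> Z p + c2 * \<alpha> (\<phi> Z) p + c3 * \<alpha> (h Z) p + c4 * \<alpha> (\<phi> (h Z)) p"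
    have "one_form A (\<lambda>X. ?q X Z)"
      using t Z by (simp add: trilinear_def)
    from c[OF this] show ?thesis
      using q1[OF Z(1)] q2[OF Z(1)] q3 q0 qxi by simp
  qed
  show "t X Y Z p = 0"
  \<comment> \<open>Expanding Y, only the \<phi> h Z term could contribute, and it is a multiple of
    \<open>?q X Z\<close>.\<close>
  proof (rule tangent_basis[OF Z XYZ(2)])
    fix c0 c1 c2 c3 c4
    assume c: "\<And>\<alpha>. one_form A \<alpha> \<Longrightarrow> \<alpha> Y p
      = c0 * \<alpha> \<xi> p + c1 * \<alpha> Z p + c2 * \<alpha> (\<phi> Z) p + c3 * \<alpha> (h Z) p + c4 * \<alpha> (\<phi> (h Z)) p"
    show ?thesis
      using c[OF form2(1)[OF XYZ(1) Z(1) Z(1)]] skew[of X \<xi> Z] xi[of X Z] d[OF XYZ(1) Z(1)]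
        dphi[OF XYZ(1) Z(1)] dh[OF XYZ(1) Z(1)] qX Z XYZ by simp
  qed
qed

lemma one_form_g_endo:
  assumes "endo_field A \<psi>" "Y \<in> VF" shows "one_form A (\<lambda>X. g (\<psi> X) Y)"
  unfolding one_form_def using assms(2) by (simp add: endo_fieldD[OF assms(1)])

lemma trilinear_endo:
  assumes "\<And>X. X \<in> VF \<Longrightarrow> endo_field A (T X)" "\<And>Y. Y \<in> VF \<Longrightarrow> endo_field A (\<lambda>X. T X Y)"
  shows "trilinear (\<lambda>X Y Z. g (T X Y) Z)"
  using assms by (simp add: trilinear_def one_form_g_endo g_form endo_fieldD(1))

lemma phih_swap: "X \<in> VF \<Longrightarrow> Y \<in> VF \<Longrightarrow> g (\<phi> (h X)) Y = - g (\<phi> (h Y)) X"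
  using phi_swap[of "h X" Y] h_swap[of "\<phi> Y" X] by simp

lemma nabla_phi:
  assumes XY: "X \<in> VF" "Y \<in> VF"
  shows "F X Y = \<eta> X \<odot> \<phi> (h Y) - \<eta> Y \<odot> (X + \<phi> (h X)) + (g X Y + g (\<phi> (h X)) Y) \<odot> \<xi>"
proof -
  \<comment> \<open>The part of \<nabla>\<phi> forced by its values on \<xi>: \<open>xi_F\<close>
    gives the \<eta>(X) term, \<open>F_xi\<close> the \<eta>(Y) term, and skewness then the
    \<xi>-component.\<close>
  define F0 where "F0 X Y = \<eta> X \<odot> \<phi> (h Y) - \<eta> Y \<odot> (X + \<phi> (h X)) + (g X Y + g (\<phi> (h X)) Y) \<odot> \<xi>" for X Y
  define T where "T X Y = F X Y - F0 X Y" for X Y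
  have F0_VF: "F0 X Y \<in> VF" if "X \<in> VF" "Y \<in> VF" for X Y
    using that by (simp add: F0_def)
  have F0: "endo_field A (F0 X)" "endo_field A (\<lambda>Y. F0 Y X)" if X: "X \<in> VF" for X
    using X unfolding endo_field_def F0_def
    by (auto simp: one_form_simps) (intro ext, simp add: fscale_def algebra_simps)+
  have T: "endo_field A (T X)" "endo_field A (\<lambda>Y. T Y X)" if X: "X \<in> VF" for X
    unfolding T_def using X by (intro endo_field_minus cov_endo_field phi_field F0; simp)+
  have T_VF [simp]: "T X Y \<in> VF" if "X \<in> VF" "Y \<in> VF" for X Y
    using that by (simp add: T_def F0_VF)
  have skew12: "T X Y = - T Y X" if "X \<in> VF" "Y \<in> VF" for X Y
    using that
    by (simp add: T_def F0_def F_sym[of X Y] phih_swap[of Y X] g_sym[of Y X])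
      (intro ext, simp add: fscale_def algebra_simps)
  have skew23: "g (T X Y) Z = - g (T X Z) Y" if "X \<in> VF" "Y \<in> VF" "Z \<in> VF" for X Y Z
    using that g_sym[of Y "F X Z"]
    by (simp add: T_def F0_VF F_skew) (simp add: F0_def fun_eq_iff phih_swap[of Z Y] algebra_simps)
  have T_xi: "T X \<xi> = 0" if "X \<in> VF" for X
    using that by (simp add: T_def F0_def F_xi) (intro ext, simp add: fscale_def algebra_simps)
  have T_phi: "T X (\<phi> Y) = - \<phi> (T X Y)" if "X \<in> VF" "Y \<in> VF" for X Y
    using that by (simp add: T_def F0_VF F_phi) (simp add: F0_def D_xi, intro ext, simp add: fscale_def algebra_simps)
  have "g (T X Y) Z = 0" if "X \<in> VF" "Y \<in> VF" "Z \<in> VF" for X Y Z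
  proof (rule three_form_zero[of "\<lambda>X Y Z. g (T X Y) Z", OF _ _ skew23 _ _ that])
    show "trilinear (\<lambda>X Y Z. g (T X Y) Z)"
      by (intro trilinear_endo T)
    show "g (T X Y) Z = - g (T Y X) Z" if "X \<in> VF" "Y \<in> VF" "Z \<in> VF" for X Y Z
      using that by (subst skew12) simp_all
    show "g (T X Y) \<xi> = 0" if "X \<in> VF" "Y \<in> VF" for X Y
      using skew23[of X Y \<xi>] T_xi that by simp
    show "g (T X (\<phi> Y)) Z = g (T X Y) (\<phi> Z)" if "X \<in> VF" "Y \<in> VF" "Z \<in> VF" for X Y Z
      using that by (simp add: T_phi)
  qed
  then have "T X Y = 0"
    using g_nondegenerate[of "T X Y"] XY by simp
  then show ?thesis by (simp add: T_def F0_def)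
qed

section \<open>The derivative of h\<close>

abbreviation "B X \<equiv> cov_endo D X h"

lemma B_VF [simp]: "X \<in> VF \<Longrightarrow> Y \<in> VF \<Longrightarrow> B X Y \<in> VF"
  by (simp add: cov_endo_def)

lemma B_skew: "X \<in> VF \<Longrightarrow> Y \<in> VF \<Longrightarrow> Z \<in> VF \<Longrightarrow> g (B X Y) Z = - g Y (B X Z)"
  by (rule cov_endo_skew[OF h_field]) auto

text \<open>The covariant derivative of h^2 = -\<open>lam\<close>^2 (I - \<eta> \<otimes> \<xi>)
  with \<open>lam\<close> constant; \<open>B_phi\<close> likewise differentiates h \<phi> + \<phi> h
  = 0.\<close>

lemma B_h:
  assumes "X \<in> VF" "Y \<in> VF"
  shows "B X (h Y) = - h (B X Y) + (lam\<^sup>2) \<odot>\<^sub>R (g (D X \<xi>) Y \<odot> \<xi> + \<eta> Y \<odot> D X \<xi>)"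
  using assms
  by (simp add: cov_endo_def D_eta D_xi vapply_const) (intro ext, simp add: fscale_def algebra_simps)

lemma B_phi:
  assumes "X \<in> VF" "Y \<in> VF"
  shows "B X (\<phi> Y) = - \<phi> (B X Y) - h (F X Y) - F X (h Y)"
  using assms by (simp add: cov_endo_def)

lemma B_xi: "X \<in> VF \<Longrightarrow> B X \<xi> = - \<phi> (h X) - h (h X)"
  by (simp add: cov_endo_def D_xi algebra_simps)

lemma bracket_D: "X \<in> VF \<Longrightarrow> Y \<in> VF \<Longrightarrow> lie_bracket X Y = D X Y - D Y X"
  using nearly_sasakian by (simp add: nearly_sasakian_def levi_civita_def torsion_def)

lemma bracket_VF [simp]: "X \<in> VF \<Longrightarrow> Y \<in> VF \<Longrightarrow> lie_bracket X Y \<in> VF"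
  by (simp add: bracket_D)

lemma d_eta: "X \<in> VF \<Longrightarrow> Y \<in> VF \<Longrightarrow> ext_deriv1 \<eta> X Y = - (2 * g (\<phi> X - h X) Y)"
  by (simp add: ext_deriv1_def D_eta bracket_D D_xi phi_swap[of Y X] h_swap[of Y X] fun_eq_iff)

text \<open>By \<open>d_eta\<close>, d\<eta> is -2 times the fundamental form of \<phi> - h. As D
  has no torsion, d(d\<eta>) = 0 says that the cyclic sum of \<nabla>(\<phi> - h) is zero.\<close>

lemma cyclic_nabla_h:
  assumes XYZ: "X \<in> VF" "Y \<in> VF" "Z \<in> VF"
  shows "g (B X Y) Z + g (B Y Z) X + g (B Z X) Y = g (F X Y) Z + g (F Y Z) X + g (F Z X) Y"
proof -
  let ?\<psi> = "\<lambda>X. \<phi> X - h X"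
  have \<psi>: "endo_field A ?\<psi>" by (intro endo_field_minus phi_field h_field)
  have cov: "cov_endo D U ?\<psi> V = F U V - B U V" if "U \<in> VF" "V \<in> VF" for U V
    using that by (simp add: cov_endo_def)
  have tor: "torsion D U V = 0" if "U \<in> VF" "V \<in> VF" for U V
    using that by (simp add: torsion_def bracket_D)
  have "ext_deriv2 (fundamental_form g ?\<psi>) X Y Z
      = g (F X Y - B X Y) Z + g (F Y Z - B Y Z) X + g (F Z X - B Z X) Y"
    by (subst ext_deriv2_fundamental_form[OF \<psi>]) (use XYZ in \<open>simp_all add: cov tor\<close>)
  moreover have "ext_deriv2 (ext_deriv1 \<eta>) X Y Z = - (2 * ext_deriv2 (fundamental_form g ?\<psi>) X Y Z)"
  proof -
    have d: "ext_deriv1 \<eta> U V = (\<lambda>p. - 2 * fundamental_form g ?\<psi> U V p)" if "U \<in> VF" "V \<in> VF" for U V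
      using d_eta[OF that] by (simp add: fundamental_form_def fun_eq_iff)
    have SF: "fundamental_form g ?\<psi> U V \<in> SF" if "U \<in> VF" "V \<in> VF" for U V
      unfolding fundamental_form_def by (rule g_SF) (use that in simp_all)
    show ?thesis
      using XYZ by (simp add: ext_deriv2_def d vapply_cmult[OF _ SF, of _ _ _ "-2", simplified] fun_eq_iff)
  qed
  moreover have "ext_deriv2 (ext_deriv1 \<eta>) X Y Z = 0"
    by (rule ext_deriv2_ext_deriv1[OF eta_form]) (use XYZ in auto)
  ultimately show ?thesis
    using XYZ by (simp add: fun_eq_iff algebra_simps)
qed

lemma nabla_h:
  assumes XY: "X \<in> VF" "Y \<in> VF"
  shows "B X Y = \<eta> X \<odot> \<phi> (h Y) - \<eta> Y \<odot> (h (h X) + \<phi> (h X)) + g (h (h X) + \<phi> (h X)) Y \<odot> \<xi>"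
proof -
  \<comment> \<open>The \<eta>(Y) and \<xi> terms are forced by \<open>B_xi\<close> and skewness.
    The \<eta>(X) \<phi> h term is invisible to them and to the relations with \<phi> and h; its
    coefficient 1 is the one that makes the cyclic sum agree with that of \<nabla>\<phi>.\<close>
  define B0 where "B0 X Y = \<eta> X \<odot> \<phi> (h Y) - \<eta> Y \<odot> (h (h X) + \<phi> (h X)) + g (h (h X) + \<phi> (h X)) Y \<odot> \<xi>" for X Y
  define S where "S X Y = B X Y - B0 X Y" for X Y
  have B0_VF: "B0 X Y \<in> VF" if "X \<in> VF" "Y \<in> VF" for X Y
    using that by (simp add: B0_def)
  have B0: "endo_field A (B0 X)" "endo_field A (\<lambda>Y. B0 Y X)" if X: "X \<in> VF" for X
    using X unfolding endo_field_def B0_def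
    by (auto simp: one_form_simps) (intro ext, simp add: fscale_def algebra_simps)+
  have S: "endo_field A (S X)" "endo_field A (\<lambda>Y. S Y X)" if X: "X \<in> VF" for X
    unfolding S_def using X by (intro endo_field_minus cov_endo_field h_field B0; simp)+
  have S_VF [simp]: "S X Y \<in> VF" if "X \<in> VF" "Y \<in> VF" for X Y
    using that by (simp add: S_def B0_VF)
  have skew: "g (S X Y) Z = - g (S X Z) Y" if "X \<in> VF" "Y \<in> VF" "Z \<in> VF" for X Y Z
    using that g_sym[of Y "B X Z"]
    by (simp add: S_def B0_VF B_skew) (simp add: B0_def fun_eq_iff phih_swap[of Z Y] algebra_simps)
  have S_xi: "S X \<xi> = 0" if "X \<in> VF" for X
    using that by (simp add: S_def B0_def B_xi) (intro ext, simp add: fscale_def algebra_simps)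
  have S_phi: "S X (\<phi> Y) = - \<phi> (S X Y)" if "X \<in> VF" "Y \<in> VF" for X Y
    using that by (simp add: S_def B0_VF B_phi nabla_phi)
      (simp add: B0_def D_xi, intro ext, simp add: fscale_def algebra_simps)
  have S_h: "S X (h Y) = - h (S X Y)" if "X \<in> VF" "Y \<in> VF" for X Y
    using that by (simp add: S_def B0_VF B_h)
      (simp add: B0_def D_xi, intro ext, simp add: fscale_def algebra_simps)
  have cyclic: "g (S X Y) Z + g (S Y Z) X + g (S Z X) Y = 0" if "X \<in> VF" "Y \<in> VF" "Z \<in> VF" for X Y Z
  proof -
    have "g (F X Y) Z + g (F Y Z) X + g (F Z X) Y = g (B0 X Y) Z + g (B0 Y Z) X + g (B0 Z X) Y"
      using that
      by (simp add: nabla_phi B0_def g_sym[of Y X] g_sym[of Z Y] g_sym[of X Z] fun_eq_iff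
          phih_swap[of Y X] phih_swap[of Z Y] phih_swap[of X Z] algebra_simps)
    then show ?thesis
      using cyclic_nabla_h[OF that] that by (simp add: S_def B0_VF algebra_simps)
  qed
  have "g (S X Y) Z = 0" if "X \<in> VF" "Y \<in> VF" "Z \<in> VF" for X Y Z
  proof (rule cyclic_form_zero[of "\<lambda>X Y Z. g (S X Y) Z", OF _ skew cyclic _ _ _ that])
    show "trilinear (\<lambda>X Y Z. g (S X Y) Z)"
      by (intro trilinear_endo S)
    show "g (S X Y) \<xi> = 0" if "X \<in> VF" "Y \<in> VF" for X Y
      using skew[of X Y \<xi>] S_xi that by simp
    show "g (S X (\<phi> Y)) Z = g (S X Y) (\<phi> Z)" "g (S X (h Y)) Z = g (S X Y) (h Z)"
      if "X \<in> VF" "Y \<in> VF" "Z \<in> VF" for X Y Z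
      using that by (simp_all add: S_phi S_h)
  qed
  then have "S X Y = 0"
    using g_nondegenerate[of "S X Y"] XY by simp
  then show ?thesis by (simp add: S_def B0_def)
qed

end

section \<open>The canonical connection\<close>

context metric_connection
begin

lemma parallel_fundamental_form:
  "endo_field A \<psi> \<Longrightarrow> parallel_endo A D \<psi> \<Longrightarrow> parallel_form2 A D (fundamental_form g \<psi>)"
  by (simp add: parallel_form2_def parallel_endo_def cov_fundamental_form)

lemma parallel_endo_scale:
  assumes "endo_field A \<psi>" "parallel_endo A D \<psi>"
  shows "parallel_endo A D (\<lambda>X. a \<odot>\<^sub>R \<psi> X)"
  using assms(2) endo_field_simps[OF assms(1)]
  by (auto simp: parallel_endo_def cov_endo_def D_const simp del: D_scale)

lemma parallel_endo_add:
  assumes "endo_field A \<psi>" "endo_field A \<psi>'" "parallel_endo A D \<psi>" "parallel_endo A D \<psi>'"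
  shows "parallel_endo A D (\<lambda>X. \<psi> X + \<psi>' X)"
  using assms(3,4) endo_field_simps[OF assms(1)] endo_field_simps[OF assms(2)]
  by (auto simp: parallel_endo_def cov_endo_def)

lemma parallel_endo_compose:
  assumes "endo_field A \<psi>" "endo_field A \<psi>'" "parallel_endo A D \<psi>" "parallel_endo A D \<psi>'"
  shows "parallel_endo A D (\<lambda>X. \<psi> (\<psi>' X))"
  using assms(3,4) endo_field_simps[OF assms(1)] endo_field_simps[OF assms(2)]
  by (auto simp: parallel_endo_def cov_endo_def)

lemma scaled_metric_connection:
  assumes "c > 0"
  shows "metric_connection A (\<lambda>X Y p. c * g X Y p) D"
proof
  show "riemannian_metric A (\<lambda>X Y p. c * g X Y p)"
    using assms g_pos unfolding riemannian_metric_def one_form_def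
    by (auto simp: algebra_simps fun_eq_iff g_sym)
  show "parallel_form2 A D (\<lambda>X Y p. c * g X Y p)"
    unfolding parallel_form2_def cov_form2_def
    by (simp add: vapply_cmult metric_derivative fun_eq_iff algebra_simps)
qed (rule connection)

end

lemma (in manifold) almost_contact_homothety:
  assumes acm: "almost_contact_metric A \<psi> \<xi> \<eta> g" and c: "c > 0"
  shows "almost_contact_metric A \<psi> ((1 / c) \<odot>\<^sub>R \<xi>) (\<lambda>X p. c * \<eta> X p) (\<lambda>X Y p. c\<^sup>2 * g X Y p)"
proof -
  note a = acm[unfolded almost_contact_metric_def]
  have \<eta>: "one_form A \<eta>" and \<xi>: "\<xi> \<in> VF" and \<eta>\<xi>: "\<eta> \<xi> = 1" and g: "riemannian_metric A g"
    using a by auto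
  have "riemannian_metric A (\<lambda>X Y p. c\<^sup>2 * g X Y p)"
    using g c unfolding riemannian_metric_def one_form_def
    by (auto simp: distrib_left mult.left_commute fun_eq_iff)
  moreover have "one_form A (\<lambda>X p. c * \<eta> X p)"
    using \<eta> unfolding one_form_def by (auto simp: algebra_simps fun_eq_iff)
  moreover have "(\<lambda>p. c * \<eta> ((1 / c) \<odot>\<^sub>R \<xi>) p) = 1"
    using one_formD(3)[OF \<eta> SF_const \<xi>] \<eta>\<xi> c by (simp add: fun_eq_iff)
  moreover have "(\<lambda>p. c * \<eta> X p) \<odot> (1 / c) \<odot>\<^sub>R \<xi> = \<eta> X \<odot> \<xi>" for X
    using c by (intro ext) (simp add: fscale_def)
  moreover have "(\<lambda>p. c\<^sup>2 * g (\<psi> X) (\<psi> Y) p) = (\<lambda>p. c\<^sup>2 * g X Y p) - (\<lambda>p. c * \<eta> X p) * (\<lambda>p. c * \<eta> Y p)"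
    if "X \<in> VF" "Y \<in> VF" for X Y
  proof -
    have e: "g (\<psi> X) (\<psi> Y) = g X Y - \<eta> X * \<eta> Y"
      using a that by blast
    show ?thesis unfolding e by (simp add: fun_eq_iff power2_eq_square algebra_simps)
  qed
  ultimately show ?thesis
    using a unfolding almost_contact_metric_def by simp
qed

context nearly_sasakian5
begin

lemma almost_contactI:
  assumes "endo_field A \<psi>" "\<And>X. X \<in> VF \<Longrightarrow> \<psi> (\<psi> X) = - X + \<eta> X \<odot> \<xi>"
    and "\<And>X Y. X \<in> VF \<Longrightarrow> Y \<in> VF \<Longrightarrow> g (\<psi> X) Y = - g X (\<psi> Y)"
  shows "almost_contact_metric A \<psi> \<xi> \<eta> g"
proof -
  have "g (\<psi> X) (\<psi> Y) = g X Y - \<eta> X * \<eta> Y" if "X \<in> VF" "Y \<in> VF" for X Y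
    using that assms(3)[of X "\<psi> Y"] assms(2)[of Y] endo_fieldD(1)[OF assms(1)]
    by (simp add: mult.commute)
  then show ?thesis
    using acm assms(1,2) unfolding almost_contact_metric_def by blast
qed

section \<open>The quaternionic triple and its rotation\<close>

definition "\<phi>1 X = (1 / lam) \<odot>\<^sub>R h X"
definition "\<phi>2 X = (1 / lam) \<odot>\<^sub>R \<phi> (h X)"
text \<open>With \<psi>3 = \<phi> - \<open>lam\<close> \<phi>1, the pair (\<psi>1, \<psi>3) is
  sqrt(1 + \<open>lam\<close>^2) times a rotation of (\<phi>1, \<phi>) that fixes \<phi>2.
  Postponing the normalisation keeps square roots out of the algebra.\<close>

definition "\<psi>1 X = \<phi>1 X + lam \<odot>\<^sub>R \<phi> X"
definition "\<psi>3 X = \<phi> X - h X"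

lemma fields: "endo_field A \<phi>1" "endo_field A \<phi>2" "endo_field A \<psi>1" "endo_field A \<psi>3"
proof -
  show 1: "endo_field A \<phi>1"
    unfolding \<phi>1_def[abs_def] by (rule endo_field_scale[OF h_field])
  show "endo_field A \<phi>2"
    unfolding \<phi>2_def[abs_def] by (rule endo_field_scale[OF endo_field_compose[OF phi_field h_field]])
  show "endo_field A \<psi>1"
    unfolding \<psi>1_def[abs_def] by (rule endo_field_add[OF 1 endo_field_scale[OF phi_field]])
  show "endo_field A \<psi>3"
    unfolding \<psi>3_def[abs_def] by (rule endo_field_minus[OF phi_field h_field])
qed

lemmas field_VF [simp] = fields[THEN endo_fieldD(1)]

lemma quaternion:
  assumes "X \<in> VF"
  shows "\<phi>1 (\<phi>1 X) = - X + \<eta> X \<odot> \<xi>" "\<phi>2 (\<phi>2 X) = - X + \<eta> X \<odot> \<xi>"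
    "\<phi>1 (\<phi>2 X) = \<phi> X" "\<phi>2 (\<phi>1 X) = - \<phi> X" "\<phi>2 (\<phi> X) = \<phi>1 X" "\<phi> (\<phi>2 X) = - \<phi>1 X"
    "\<phi> (\<phi>1 X) = \<phi>2 X" "\<phi>1 (\<phi> X) = - \<phi>2 X"
  using assms lam unfolding \<phi>1_def \<phi>2_def
  by (simp_all; intro ext, simp add: fscale_def field_simps power2_eq_square)+

lemma quaternion_psi:
  assumes "X \<in> VF"
  shows "\<psi>1 (\<psi>1 X) = (1 + lam\<^sup>2) \<odot>\<^sub>R (- X + \<eta> X \<odot> \<xi>)" "\<psi>3 (\<psi>3 X) = (1 + lam\<^sup>2) \<odot>\<^sub>R (- X + \<eta> X \<odot> \<xi>)"
    "\<psi>1 (\<phi>2 X) = \<psi>3 X" "\<phi>2 (\<psi>1 X) = - \<psi>3 X" "\<phi>2 (\<psi>3 X) = \<psi>1 X" "\<psi>3 (\<phi>2 X) = - \<psi>1 X"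
    "\<psi>3 (\<psi>1 X) = (1 + lam\<^sup>2) \<odot>\<^sub>R \<phi>2 X" "\<psi>1 (\<psi>3 X) = - ((1 + lam\<^sup>2) \<odot>\<^sub>R \<phi>2 X)"
  using assms lam unfolding \<psi>1_def \<psi>3_def \<phi>1_def \<phi>2_def
  by (simp_all; intro ext, simp add: fscale_def field_simps power2_eq_square)+

lemma skew:
  assumes "X \<in> VF" "Y \<in> VF"
  shows "g (\<phi>1 X) Y = - g X (\<phi>1 Y)" "g (\<phi>2 X) Y = - g X (\<phi>2 Y)"
    "g (\<psi>1 X) Y = - g X (\<psi>1 Y)" "g (\<psi>3 X) Y = - g X (\<psi>3 Y)"
  using assms by (simp_all add: \<phi>1_def \<phi>2_def \<psi>1_def \<psi>3_def fun_eq_iff algebra_simps)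

lemma su2: "su2_structure A \<phi>1 \<phi>2 \<phi> \<xi> \<eta> g"
  unfolding su2_structure_def
  using acm quaternion almost_contactI[OF fields(1)] almost_contactI[OF fields(2)] skew by simp

definition "s = sqrt (1 + lam\<^sup>2)"

lemma s: "s > 0" "s\<^sup>2 = 1 + lam\<^sup>2"
  unfolding s_def by (auto simp: add_pos_nonneg)

definition "\<phi>t1 X = (1 / s) \<odot>\<^sub>R \<psi>1 X"
definition "\<phi>t X = (1 / s) \<odot>\<^sub>R \<psi>3 X"
definition "\<eta>t X p = s * \<eta> X p"
definition "\<xi>t = (1 / s) \<odot>\<^sub>R \<xi>"
definition "gt X Y p = s\<^sup>2 * g X Y p"

lemma fields_t: "endo_field A \<phi>t1" "endo_field A \<phi>t"
  unfolding \<phi>t1_def[abs_def] \<phi>t_def[abs_def]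
  by (rule endo_field_scale[OF fields(3)], rule endo_field_scale[OF fields(4)])

lemmas fields_t_VF [simp] = fields_t[THEN endo_fieldD(1)]

lemma s_cancel: "(\<lambda>_. 1 / s) \<odot> (\<lambda>_. 1 / s) \<odot> (1 + lam\<^sup>2) \<odot>\<^sub>R X = X"
proof -
  have "1 / s * (1 / s * ((1 + lam\<^sup>2) * v)) = v" for v
    unfolding s(2)[symmetric] using s(1) by (simp add: power2_eq_square)
  then show ?thesis by (intro ext) (simp only: fscale_def)
qed

lemma quaternion_t:
  assumes "X \<in> VF"
  shows "\<phi>t1 (\<phi>t1 X) = - X + \<eta> X \<odot> \<xi>" "\<phi>t (\<phi>t X) = - X + \<eta> X \<odot> \<xi>"
    "\<phi>t1 (\<phi>2 X) = \<phi>t X" "\<phi>2 (\<phi>t1 X) = - \<phi>t X" "\<phi>2 (\<phi>t X) = \<phi>t1 X" "\<phi>t (\<phi>2 X) = - \<phi>t1 X"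
    "\<phi>t (\<phi>t1 X) = \<phi>2 X" "\<phi>t1 (\<phi>t X) = - \<phi>2 X"
proof -
  have m: "f \<odot> (- U) = - (f \<odot> U)" for f and U :: "'m vfield"
    by (intro ext) (simp add: fscale_def)
  note [simp] = endo_field_simps[OF fields(2)] endo_field_simps[OF fields(3)] endo_field_simps[OF fields(4)]
  show "\<phi>t1 (\<phi>t1 X) = - X + \<eta> X \<odot> \<xi>" "\<phi>t (\<phi>t X) = - X + \<eta> X \<odot> \<xi>"
    "\<phi>t1 (\<phi>2 X) = \<phi>t X" "\<phi>2 (\<phi>t1 X) = - \<phi>t X" "\<phi>2 (\<phi>t X) = \<phi>t1 X" "\<phi>t (\<phi>2 X) = - \<phi>t1 X"
    "\<phi>t (\<phi>t1 X) = \<phi>2 X" "\<phi>t1 (\<phi>t X) = - \<phi>2 X"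
    unfolding \<phi>t1_def \<phi>t_def using assms by (simp_all add: quaternion_psi s_cancel m)
qed

lemma skew_t:
  assumes "X \<in> VF" "Y \<in> VF"
  shows "g (\<phi>t1 X) Y = - g X (\<phi>t1 Y)" "g (\<phi>t X) Y = - g X (\<phi>t Y)"
  using assms skew[OF assms] by (simp_all add: \<phi>t1_def \<phi>t_def fun_eq_iff)

lemma acm_t:
  assumes "almost_contact_metric A \<psi> \<xi> \<eta> g"
  shows "almost_contact_metric A \<psi> \<xi>t \<eta>t gt"
  using almost_contact_homothety[OF assms s(1)]
  unfolding \<xi>t_def \<eta>t_def[abs_def] gt_def[abs_def] by simp

lemma su2_t: "su2_structure A \<phi>t1 \<phi>2 \<phi>t \<xi>t \<eta>t gt"
  unfolding su2_structure_def
  by (intro conjI ballI acm_t almost_contactI fields fields_t quaternion quaternion_t skew skew_t)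

lemma forms_t:
  assumes "X \<in> VF" "Y \<in> VF"
  shows "fundamental_form gt \<phi>t1 X Y p
      = s * (fundamental_form g \<phi>1 X Y p + lam * fundamental_form g \<phi> X Y p)"
    "fundamental_form gt \<phi>2 X Y p = (1 + lam\<^sup>2) * fundamental_form g \<phi>2 X Y p"
    "fundamental_form gt \<phi>t X Y p
      = s * (fundamental_form g \<phi> X Y p - lam * fundamental_form g \<phi>1 X Y p)"
  using assms s(1) lam
  by (simp_all add: fundamental_form_def gt_def \<phi>t1_def \<phi>t_def \<psi>1_def \<psi>3_def \<phi>1_def s(2)[symmetric])
    (simp_all add: power2_eq_square field_simps)

section \<open>The canonical connection and its parallel tensors\<close>

definition "H X Y = (1/2) \<odot>\<^sub>R F X (\<phi> Y) - (1/2) \<odot>\<^sub>R (\<eta> X \<odot> \<phi> Y)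
    + \<eta> Y \<odot> (\<phi> X - h X) - (1/2) \<odot>\<^sub>R (g (\<phi> X - h X) Y \<odot> \<xi>)"
definition "Db X Y = D X Y + H X Y"

text \<open>By \<open>nabla_phi\<close>, half of (\<nabla>_X \<phi>)\<phi> Y consists of \<eta>(X) h
  Y / 2 and - g((\<phi> - h)X, Y)\<xi> / 2. The first completes \<phi> to \<phi> - h, the second
  doubles the existing \<xi> term; only \<phi> - h remains, which is what makes the Okumura form
  possible.\<close>

lemma H_eq:
  assumes "X \<in> VF" "Y \<in> VF"
  shows "H X Y = - ((1/2) \<odot>\<^sub>R (\<eta> X \<odot> (\<phi> Y - h Y))) + \<eta> Y \<odot> (\<phi> X - h X) - g (\<phi> X - h X) Y \<odot> \<xi>"
  using assms
  by (simp add: H_def nabla_phi) (intro ext, simp add: fscale_def field_simps)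

lemma H_VF [simp]: "X \<in> VF \<Longrightarrow> Y \<in> VF \<Longrightarrow> H X Y \<in> VF"
  by (simp add: H_eq)

lemma Db_affine: "affine_connection A Db"
  unfolding affine_connection_def Db_def
  by (auto simp: H_eq; intro ext, simp add: fscale_def field_simps)

lemma Db_metric: "parallel_form2 A Db g"
proof -
  have "g (H X Y) Z + g Y (H X Z) = 0" if "X \<in> VF" "Y \<in> VF" "Z \<in> VF" for X Y Z
    using that by (simp add: H_eq fun_eq_iff phi_swap[of X Y] phi_swap[of Z Y] phi_swap[of X Z]
        h_swap[of X Y] h_swap[of Z Y] h_swap[of X Z] field_simps)
  then show ?thesis
    unfolding parallel_form2_def cov_form2_def Db_def
    by (auto simp: metric_derivative algebra_simps)
qed

end

sublocale nearly_sasakian5 \<subseteq> b: metric_connection A g Db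
  by unfold_locales (rule metric Db_affine Db_metric)+

context nearly_sasakian5
begin

lemma Db_phi: "parallel_endo A Db \<phi>"
proof -
  have "F X Y + H X (\<phi> Y) - \<phi> (H X Y) = 0" if "X \<in> VF" "Y \<in> VF" for X Y
    using that by (simp add: nabla_phi H_eq) (intro ext, simp add: fscale_def field_simps)
  then show ?thesis
    unfolding parallel_endo_def by (auto simp: cov_endo_def Db_def algebra_simps)
qed

text \<open>Here r = 1/2 is decisive: as \<phi> and h anticommute, the commutator of -r\<phi> with h
  is -2r \<phi> h, which must cancel the term \<eta>(X) \<phi> h Y of
  \<open>nabla_h\<close>.\<close>

lemma Db_h: "parallel_endo A Db h"
proof -
  have "B X Y + H X (h Y) - h (H X Y) = 0" if "X \<in> VF" "Y \<in> VF" for X Y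
    using that by (simp add: nabla_h H_eq) (intro ext, simp add: fscale_def field_simps)
  then show ?thesis
    unfolding parallel_endo_def by (auto simp: cov_endo_def Db_def algebra_simps)
qed

lemma Db_xi: "X \<in> VF \<Longrightarrow> Db X \<xi> = 0"
  by (simp add: Db_def H_eq D_xi) (intro ext, simp add: fscale_def)

lemma Db_eta: "X \<in> VF \<Longrightarrow> Y \<in> VF \<Longrightarrow> X \<bullet>\<^sub>v \<eta> Y = \<eta> (Db X Y)"
  using b.metric_derivative[of X Y \<xi>] by (simp add: Db_xi)

lemma Db_fields: "parallel_endo A Db \<phi>1" "parallel_endo A Db \<phi>2" "parallel_endo A Db \<psi>1"
  "parallel_endo A Db \<psi>3" "parallel_endo A Db \<phi>t1" "parallel_endo A Db \<phi>t"
proof -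
  show 1: "parallel_endo A Db \<phi>1"
    unfolding \<phi>1_def[abs_def] by (rule b.parallel_endo_scale[OF h_field Db_h])
  show "parallel_endo A Db \<phi>2"
    unfolding \<phi>2_def[abs_def]
    by (rule b.parallel_endo_scale[OF endo_field_compose[OF phi_field h_field]
          b.parallel_endo_compose[OF phi_field h_field Db_phi Db_h]])
  show p1: "parallel_endo A Db \<psi>1"
    unfolding \<psi>1_def[abs_def]
    by (rule b.parallel_endo_add[OF fields(1) endo_field_scale[OF phi_field] 1
          b.parallel_endo_scale[OF phi_field Db_phi]])
  show p3: "parallel_endo A Db \<psi>3"
    using b.parallel_endo_add[OF phi_field endo_field_scale[OF h_field] Db_phi
          b.parallel_endo_scale[OF h_field Db_h], of "- 1"]
    unfolding \<psi>3_def[abs_def] fscale_minus1 by simp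
  show "parallel_endo A Db \<phi>t1" "parallel_endo A Db \<phi>t"
    unfolding \<phi>t1_def[abs_def] \<phi>t_def[abs_def]
    by (rule b.parallel_endo_scale[OF fields(3) p1], rule b.parallel_endo_scale[OF fields(4) p3])
qed

lemma parallel_su2: "parallel_su2 A Db \<phi>1 \<phi>2 \<phi> \<xi> \<eta> g"
  unfolding parallel_su2_def parallel_vfield_def parallel_form1_def cov_form1_def
  using Db_fields Db_phi Db_metric by (simp add: Db_xi Db_eta)

lemma parallel_su2_forms: "parallel_su2_forms A Db \<eta> (fundamental_form g \<phi>1) (fundamental_form g \<phi>2) (fundamental_form g \<phi>)"
  unfolding parallel_su2_forms_def
  using parallel_su2 Db_fields Db_phi fields phi_field b.parallel_fundamental_form
  by (simp add: parallel_su2_def)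

text \<open>Antisymmetrise \<open>H_eq\<close>: the coefficients 1 and 1/2 of the \<eta> terms add
  up to 3/2, and the skew \<xi> term doubles.\<close>

lemma torsion_Db:
  assumes "X \<in> VF" "Y \<in> VF"
  shows "torsion Db X Y = (3/2) \<odot>\<^sub>R (\<eta> Y \<odot> (\<phi> X - h X) - \<eta> X \<odot> (\<phi> Y - h Y)) - (2 * g (\<phi> X - h X) Y) \<odot> \<xi>"
proof -
  have "torsion Db X Y = H X Y - H Y X"
    using assms by (simp add: torsion_def Db_def bracket_D)
  then show ?thesis
    using assms by (simp add: H_eq phi_swap[of Y X] h_swap[of Y X])
      (intro ext, simp add: fscale_def field_simps)
qed

lemma parallel_torsion: "parallel_vform2 A Db (torsion Db)"
proof -
  have c: "Db X (\<phi> Y) = \<phi> (Db X Y)" "Db X (h Y) = h (Db X Y)" if "X \<in> VF" "Y \<in> VF" for X Y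
    using Db_phi Db_h that by (auto simp: parallel_endo_def cov_endo_def)
  \<comment> \<open>The 2 in \<open>torsion_Db\<close> is a constant function on the manifold, and
    the Leibniz rule differentiates it.\<close>
  have two: "X \<bullet>\<^sub>v 2 = 0" if "X \<in> VF" for X
    using vapply_const[OF that, of 2] by (simp add: numeral_fun)
  show ?thesis
    unfolding parallel_vform2_def cov_vform2_def
    by (auto simp: torsion_Db c Db_xi Db_eta vapply_const vapply_mult vapply_diff b.metric_derivative two)
      (intro ext, simp add: fscale_def field_simps)
qed

end

section \<open>The Sasaki-Einstein structure and the Okumura connection\<close>

sublocale nearly_sasakian5 \<subseteq> bt: metric_connection A gt Db
  unfolding gt_def[abs_def] using s(1) by (intro b.scaled_metric_connection) simp

sublocale nearly_sasakian5 \<subseteq> t: metric_connection A gt D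
  unfolding gt_def[abs_def] using s(1) by (intro scaled_metric_connection) simp

context nearly_sasakian5
begin

lemma parallel_su2_t: "parallel_su2 A Db \<phi>t1 \<phi>2 \<phi>t \<xi>t \<eta>t gt"
proof -
  have "Db X \<xi>t = 0" if "X \<in> VF" for X
    using b.D_const[OF that xi_VF] Db_xi[OF that] by (simp add: \<xi>t_def)
  moreover have "X \<bullet>\<^sub>v \<eta>t Y - \<eta>t (Db X Y) = 0" if "X \<in> VF" "Y \<in> VF" for X Y
    using that by (simp add: \<eta>t_def[abs_def] vapply_cmult Db_eta fun_eq_iff)
  ultimately show ?thesis
    unfolding parallel_su2_def parallel_vfield_def parallel_form1_def cov_form1_def
    using Db_fields bt.parallel_metric by simp
qed

lemma H_t:
  assumes "X \<in> VF" "Y \<in> VF"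
  shows "H X Y = gt X (\<phi>t Y) \<odot> \<xi>t - (1/2) \<odot>\<^sub>R (\<eta>t X \<odot> \<phi>t Y) + \<eta>t Y \<odot> \<phi>t X"
  using assms s(1)
  by (simp add: H_eq gt_def[abs_def] \<phi>t_def \<xi>t_def \<eta>t_def[abs_def] \<psi>3_def)
    (intro ext, simp add: fscale_def field_simps power2_eq_square)

lemma Db_okumura:
  "X \<in> VF \<Longrightarrow> Y \<in> VF \<Longrightarrow> Db X Y = okumura D \<phi>t \<xi>t \<eta>t gt (1/2) X Y"
  by (simp add: Db_def okumura_def H_t algebra_simps)

text \<open>In \<nabla>\<phi> - \<nabla>h all \<phi> h terms cancel, and X - h^2 X is (1 +
  \<open>lam\<close>^2) X up to a multiple of \<xi>. A constant rescaling of g does not change its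
  Levi-Civita connection.\<close>

lemma sasakian_t: "sasakian A D \<phi>t \<xi>t \<eta>t gt"
proof -
  have "levi_civita A gt D"
    using t.metric t.connection t.parallel_metric nearly_sasakian
    by (simp add: levi_civita_def nearly_sasakian_def)
  moreover have "cov_endo D X \<phi>t Y = gt X Y \<odot> \<xi>t - \<eta>t Y \<odot> X" if "X \<in> VF" "Y \<in> VF" for X Y
  proof -
    have "cov_endo D X \<phi>t Y = (1 / s) \<odot>\<^sub>R (F X Y - B X Y)"
      using that by (simp add: cov_endo_def \<phi>t_def \<psi>3_def D_const del: D_scale)
        (intro ext, simp add: fscale_def algebra_simps)
    also have "F X Y - B X Y = s\<^sup>2 \<odot>\<^sub>R (g X Y \<odot> \<xi> - \<eta> Y \<odot> X)"
      unfolding s(2) using that by (simp add: nabla_phi nabla_h) (intro ext, simp add: fscale_def algebra_simps)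
    finally show ?thesis
      using s(1) by (simp add: gt_def[abs_def] \<xi>t_def \<eta>t_def[abs_def])
        (intro ext, simp add: fscale_def field_simps power2_eq_square)
  qed
  ultimately show ?thesis
    using su2_t by (simp add: sasakian_def su2_structure_def)
qed

text \<open>Computed with \<open>Db\<close> instead of \<open>D\<close>: the endomorphisms are
  parallel, so the exterior derivatives of the first two forms come from the torsion alone. Its
  \<xi> part is annihilated, and each remaining term occurs twice in the cyclic sum, so 3/2 becomes
  3. The equation for the 1-form is \<open>d_eta\<close> rescaled.\<close>

lemma sasaki_einstein_t:
  "sasaki_einstein_equations A \<eta>t (fundamental_form gt \<phi>t1) (fundamental_form gt \<phi>2) (fundamental_form gt \<phi>t)"
proof -
  let ?T = "torsion Db"
  have \<psi>3: "\<psi>3 X = s \<odot>\<^sub>R \<phi>t X" for X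
    using s(1) by (intro ext) (simp add: \<phi>t_def fscale_def)
  have tor: "?T X Y = (3/2) \<odot>\<^sub>R s \<odot>\<^sub>R (\<eta> Y \<odot> \<phi>t X - \<eta> X \<odot> \<phi>t Y) - (2 * g (\<psi>3 X) Y) \<odot> \<xi>"
    if "X \<in> VF" "Y \<in> VF" for X Y
    unfolding torsion_Db[OF that] \<psi>3_def[symmetric] \<psi>3
    by (intro ext) (simp add: fscale_def algebra_simps)
  have xi0: "\<phi>2 \<xi> = 0" "\<phi>t1 \<xi> = 0"
    by (simp_all add: \<phi>1_def \<phi>2_def \<psi>1_def \<phi>t1_def)
  have gt_skew1: "gt (\<phi>t1 X) Y = - gt X (\<phi>t1 Y)" and gt_skew2: "gt (\<phi>2 X) Y = - gt X (\<phi>2 Y)"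
    if "X \<in> VF" "Y \<in> VF" for X Y
    using skew_t(1)[OF that] skew(2)[OF that] by (simp_all add: gt_def[abs_def] fun_eq_iff)
  have swap1: "gt (\<phi>t1 X) Y = - gt (\<phi>t1 Y) X" and swap2: "gt (\<phi>2 X) Y = - gt (\<phi>2 Y) X"
    if "X \<in> VF" "Y \<in> VF" for X Y
    using gt_skew1[OF that] gt_skew2[OF that] t.g_sym[of X "\<phi>t1 Y"] t.g_sym[of X "\<phi>2 Y"] that by simp_all
  note [simp] = endo_field_simps[OF fields(2)] endo_field_simps[OF fields_t(1)]
  have cov: "cov_endo Db X \<phi>t1 Y = 0" "cov_endo Db X \<phi>2 Y = 0" if "X \<in> VF" "Y \<in> VF" for X Y
    using Db_fields(2,5) that by (auto simp: parallel_endo_def)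
  have T_VF: "?T X Y \<in> VF" if "X \<in> VF" "Y \<in> VF" for X Y
    using that by (simp add: torsion_def)
  have T1: "\<phi>t1 (?T X Y) = (3/2) \<odot>\<^sub>R s \<odot>\<^sub>R (\<eta> X \<odot> \<phi>2 Y - \<eta> Y \<odot> \<phi>2 X)"
    and T2: "\<phi>2 (?T X Y) = (3/2) \<odot>\<^sub>R s \<odot>\<^sub>R (\<eta> Y \<odot> \<phi>t1 X - \<eta> X \<odot> \<phi>t1 Y)"
    if "X \<in> VF" "Y \<in> VF" for X Y
    using that by (simp_all add: tor xi0 quaternion_t) (intro ext, simp add: fscale_def algebra_simps)
  have "ext_deriv1 \<eta>t X Y = - 2 * fundamental_form gt \<phi>t X Y" if "X \<in> VF" "Y \<in> VF" for X Y
  proof -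
    have "ext_deriv1 \<eta>t X Y = (\<lambda>p. s * ext_deriv1 \<eta> X Y p)"
      using that by (simp add: ext_deriv1_def \<eta>t_def[abs_def] vapply_cmult fun_eq_iff algebra_simps)
    also have "\<dots> = - 2 * fundamental_form gt \<phi>t X Y"
      using that s(1) unfolding d_eta[OF that] \<psi>3_def[symmetric]
      by (simp add: fundamental_form_def gt_def[abs_def] \<psi>3 fun_eq_iff power2_eq_square)
    finally show ?thesis .
  qed
  moreover have "ext_deriv2 (fundamental_form gt \<phi>t1) X Y Z = 3 * wedge12 \<eta>t (fundamental_form gt \<phi>2) X Y Z"
    if "X \<in> VF" "Y \<in> VF" "Z \<in> VF" for X Y Z
    using that
    by (subst bt.ext_deriv2_fundamental_form[OF fields_t(1) gt_skew1])
      (simp_all add: cov T1 wedge12_def fundamental_form_def \<eta>t_def[abs_def] fun_eq_iff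
        swap2[of Y X] swap2[of Z Y] swap2[of X Z] field_simps)
  moreover have "ext_deriv2 (fundamental_form gt \<phi>2) X Y Z = - 3 * wedge12 \<eta>t (fundamental_form gt \<phi>t1) X Y Z"
    if "X \<in> VF" "Y \<in> VF" "Z \<in> VF" for X Y Z
    using that
    by (subst bt.ext_deriv2_fundamental_form[OF fields(2) gt_skew2])
      (simp_all add: cov T2 wedge12_def fundamental_form_def \<eta>t_def[abs_def] fun_eq_iff
        swap1[of Y X] swap1[of Z Y] swap1[of X Z] field_simps)
  ultimately show ?thesis
    by (simp add: sasaki_einstein_equations_def)
qed

lemma parallel_su2_forms_t:
  "parallel_su2_forms A Db \<eta>t (fundamental_form gt \<phi>t1) (fundamental_form gt \<phi>2) (fundamental_form gt \<phi>t)"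
  using parallel_su2_t Db_fields fields fields_t bt.parallel_fundamental_form
  by (simp add: parallel_su2_forms_def parallel_su2_def)

end

text \<open>\<open>su2_forms\<close> gives equality on vector fields only, and the exterior
  derivative also evaluates the forms on brackets; hence the closure hypothesis.\<close>

lemma sasaki_einstein_equations_cong:
  assumes "\<And>X Y. X \<in> vector_fields A \<Longrightarrow> Y \<in> vector_fields A \<Longrightarrow> lie_bracket X Y \<in> vector_fields A"
    and "su2_forms A \<phi>1 \<phi>2 \<phi>3 g \<omega>1 \<omega>2 \<omega>3"
    and "sasaki_einstein_equations A \<eta> (fundamental_form g \<phi>1) (fundamental_form g \<phi>2) (fundamental_form g \<phi>3)"
  shows "sasaki_einstein_equations A \<eta> \<omega>1 \<omega>2 \<omega>3"
  using assms by (simp add: sasaki_einstein_equations_def su2_forms_def wedge12_def ext_deriv2_def)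

lemma parallel_su2_forms_cong:
  assumes "affine_connection A D" "su2_forms A \<phi>1 \<phi>2 \<phi>3 g \<omega>1 \<omega>2 \<omega>3"
    and "parallel_su2_forms A D \<eta> (fundamental_form g \<phi>1) (fundamental_form g \<phi>2) (fundamental_form g \<phi>3)"
  shows "parallel_su2_forms A D \<eta> \<omega>1 \<omega>2 \<omega>3"
  using assms
  by (simp add: parallel_su2_forms_def su2_forms_def parallel_form2_def cov_form2_def affine_connection_def)

theorem mainTheorem18:
  fixes A :: "('m::{t2_space,second_countable_topology}, real^5) atlas"
    and D Db :: "'m connection"
    and \<phi> h \<phi>1 \<phi>2 \<phi>3 \<phi>t :: "'m endo"
    and \<xi> \<xi>t :: "'m vfield"
    and \<eta> \<eta>t :: "'m form1"
    and g gt \<omega>1 \<omega>2 \<omega>3 \<omega>t1 \<omega>t2 \<omega>t3 :: "'m form2"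
    and H Tb :: "'m vform2"
    and lam :: real
  assumes "smooth_atlas A" and "connected (UNIV :: 'm set)"
    and "nearly_sasakian A D \<phi> \<xi> \<eta> g" and "\<not> sasakian A D \<phi> \<xi> \<eta> g"
    and "\<And>X. X \<in> vector_fields A \<Longrightarrow> D X \<xi> = - \<phi> X + h X"
    and "lam \<noteq> 0"
    and "\<And>X. X \<in> vector_fields A \<Longrightarrow> h (h X) = (- (lam\<^sup>2)) \<odot>\<^sub>R (X - \<eta> X \<odot> \<xi>)"
    and "H = (\<lambda>X Y. (1/2) \<odot>\<^sub>R cov_endo D X \<phi> (\<phi> Y) - (1/2) \<odot>\<^sub>R (\<eta> X \<odot> \<phi> Y)
                  + \<eta> Y \<odot> (\<phi> X - h X) - (1/2) \<odot>\<^sub>R (g (\<phi> X - h X) Y \<odot> \<xi>))"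
    and "Db = (\<lambda>X Y. D X Y + H X Y)"
    and "Tb = torsion Db"
    and "\<phi>1 = (\<lambda>X. (1/lam) \<odot>\<^sub>R h X)"
    and "\<phi>2 = (\<lambda>X. (1/lam) \<odot>\<^sub>R \<phi> (h X))"
    and "\<phi>3 = \<phi>"
    and "\<omega>1 = fundamental_form g \<phi>1"
    and "\<omega>2 = fundamental_form g \<phi>2"
    and "\<omega>3 = fundamental_form g \<phi>3"
    and "\<eta>t = (\<lambda>X p. sqrt (1 + lam\<^sup>2) * \<eta> X p)"
    and "\<omega>t1 = (\<lambda>X Y p. sqrt (1 + lam\<^sup>2) * (\<omega>1 X Y p + lam * \<omega>3 X Y p))"
    and "\<omega>t2 = (\<lambda>X Y p. (1 + lam\<^sup>2) * \<omega>2 X Y p)"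
    and "\<omega>t3 = (\<lambda>X Y p. sqrt (1 + lam\<^sup>2) * (\<omega>3 X Y p - lam * \<omega>1 X Y p))"
    and "\<phi>t = (\<lambda>X. (1 / sqrt (1 + lam\<^sup>2)) \<odot>\<^sub>R (\<phi> X - h X))"
    and "\<xi>t = (1 / sqrt (1 + lam\<^sup>2)) \<odot>\<^sub>R \<xi>"
    and "gt = (\<lambda>X Y p. (1 + lam\<^sup>2) * g X Y p)"
  shows
    "affine_connection A Db \<and>
     su2_structure A \<phi>1 \<phi>2 \<phi>3 \<xi> \<eta> g \<and>
     parallel_su2 A Db \<phi>1 \<phi>2 \<phi>3 \<xi> \<eta> g \<and>
     parallel_su2_forms A Db \<eta> \<omega>1 \<omega>2 \<omega>3 \<and>
     (\<forall>X \<in> vector_fields A. \<forall>Y \<in> vector_fields A.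
        Tb X Y = (3/2) \<odot>\<^sub>R (\<eta> Y \<odot> (\<phi> X - h X) - \<eta> X \<odot> (\<phi> Y - h Y))
                 - (2 * g (\<phi> X - h X) Y) \<odot> \<xi>) \<and>
     parallel_vform2 A Db Tb \<and>
     (\<exists>\<phi>t1 \<phi>t2.
        su2_structure A \<phi>t1 \<phi>t2 \<phi>t \<xi>t \<eta>t gt \<and>
        su2_forms A \<phi>t1 \<phi>t2 \<phi>t gt \<omega>t1 \<omega>t2 \<omega>t3 \<and>
        parallel_su2 A Db \<phi>t1 \<phi>t2 \<phi>t \<xi>t \<eta>t gt) \<and>
     sasaki_einstein_equations A \<eta>t \<omega>t1 \<omega>t2 \<omega>t3 \<and>
     parallel_su2_forms A Db \<eta>t \<omega>t1 \<omega>t2 \<omega>t3 \<and>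
     (\<forall>X \<in> vector_fields A. \<forall>Y \<in> vector_fields A.
        H X Y = gt X (\<phi>t Y) \<odot> \<xi>t - (1/2) \<odot>\<^sub>R (\<eta>t X \<odot> \<phi>t Y) + \<eta>t Y \<odot> \<phi>t X) \<and>
     sasakian A D \<phi>t \<xi>t \<eta>t gt \<and>
     (\<forall>X \<in> vector_fields A. \<forall>Y \<in> vector_fields A.
        Db X Y = okumura D \<phi>t \<xi>t \<eta>t gt (1/2) X Y)"
proof -
  interpret N: nearly_sasakian5 A D \<phi> h \<xi> \<eta> g lam
    using assms(1,3,5-7) by unfold_locales auto
  have H: "H = N.H"
    unfolding assms(8) by (intro ext) (simp only: N.H_def)
  have Db: "Db = N.Db"
    unfolding assms(9) H by (intro ext) (simp only: N.Db_def)
  have \<phi>1: "\<phi>1 = N.\<phi>1" and \<phi>2: "\<phi>2 = N.\<phi>2"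
    unfolding assms(11,12) by (intro ext; simp only: N.\<phi>1_def N.\<phi>2_def)+
  have \<phi>t: "\<phi>t = N.\<phi>t" and \<xi>t: "\<xi>t = N.\<xi>t" and \<eta>t: "\<eta>t = N.\<eta>t"
    unfolding assms(17,21,22) N.s_def[symmetric]
    by (intro ext; simp only: N.\<phi>t_def N.\<psi>3_def N.\<xi>t_def N.\<eta>t_def)+
  have gt: "gt = N.gt"
    unfolding assms(23) by (intro ext) (simp only: N.gt_def N.s(2))
  \<comment> \<open>\<open>N.\<phi>t1\<close> and \<open>N.\<phi>2\<close> are the witnesses for the
    first two endomorphisms; the second stays unchanged because the rotation fixes it.\<close>
  have forms_t: "su2_forms A N.\<phi>t1 N.\<phi>2 N.\<phi>t N.gt \<omega>t1 \<omega>t2 \<omega>t3"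
    unfolding su2_forms_def fun_eq_iff assms(13-16,18-20) \<phi>1 \<phi>2 N.s_def[symmetric]
    using N.forms_t by simp
  show ?thesis
    unfolding assms(10,13-16) H Db \<phi>1 \<phi>2 \<phi>t \<xi>t \<eta>t gt
    using N.Db_affine N.su2 N.parallel_su2 N.parallel_su2_forms N.torsion_Db N.parallel_torsion
      N.su2_t forms_t N.parallel_su2_t N.sasakian_t N.H_t N.Db_okumura
      sasaki_einstein_equations_cong[OF N.bracket_VF forms_t N.sasaki_einstein_t]
      parallel_su2_forms_cong[OF N.Db_affine forms_t N.parallel_su2_forms_t]
    by blast
qed

end
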